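(* Let $\{p_k\}_{k\ge0}$ be the antisymmetric orthogonal polynomials on the Sierpinski gasket $SG$ obtained from $\{P_{k3}\}_{k\ge 0}$ by the monic Gram–Schmidt process, and write $p_k=\sum_{\ell=0}^k\omega_{k,\ell}P_{\ell3}$ with $\omega_{k,k}=1$, and $\Omega_k=(\omega_{k,0},\omega_{k,1},\dots,\omega_{k,k})^T\in\mathbb{R}^{k+1}$. Let $d_k=\|p_k\|_{L^2}^{-1}$, $f_{k+1}(x)=-\int_{SG}G(x,y)p_k(y)\,d\mu(y)$, $b_k=d_k^2\langle f_{k+1},p_k\rangle$ for $k\ge0$, $c_k=d_{k-1}^2/d_k^2$ for $k\ge1$, $\gamma_\ell=P_{\ell3}(q_1)$, and $$\zeta_k=-\frac1{\gamma_0}\sum_{\ell=0}^k\omega_{k,\ell}\,\gamma_{\ell+1}.$$ Then for each $k\ge0$, as vectors in $\mathbb{R}^{k+2}$, $$\Omega_{k+1}=\begin{pmatrix}\zeta_k\\ \Omega_k\end{pmatrix}-b_k\begin{pmatrix}\Omega_k\\0\end{pmatrix}-c_k\begin{pmatrix}\Omega_{k-1}\\0\\0\end{pmatrix},$$ where for $k=0$ the last term is omitted.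
   Context: Sierpinski gasket: let $q_0,q_1,q_2$ be the vertices of an equilateral triangle in $\mathbb{R}^2$, $F_i(x)=\tfrac12(x-q_i)+q_i$, and $SG$ the nonempty compact set with $SG=\bigcup_{i=0}^2F_i(SG)$. For a word $w=(w_1,\dots,w_m)$, $F_w=F_{w_1}\circ\cdots\circ F_{w_m}$ and $F_w(SG)$ is a cell of level $m$. $V_0=\{q_0,q_1,q_2\}$ is the boundary, $V_m=\bigcup_iF_iV_{m-1}$, $V_*=\bigcup_mV_m$; for distinct $x,y\in V_m$, $x\sim_m y$ iff $x,y$ lie in a common cell of level $m$. $\mu$ is the probability measure on $SG$ giving mass $3^{-m}$ to each cell of level $m$; all functions are real-valued, $\langle f,g\rangle=\int_{SG}fg\,d\mu$ and $\|f\|_{L^2}^2=\langle f,f\rangle$. Laplacian: $\Delta u(x)=\lim_{m\to\infty}\tfrac32 5^m\sum_{y\sim_m x}(u(y)-u(x))$ for $x\in V_*\setminus V_0$; a continuous $u$ is in the domain with $\Delta u=f$ ($f$ continuous on $SG$) if these limits converge uniformly to $f$ on $V_*\setminus V_0$. Derivatives at $q_0$: $\partial_nu(q_0)=\lim_m(5/3)^m\big(2u(q_0)-u(F_0^mq_1)-u(F_0^mq_2)\big)$ and $\partial_Tu(q_0)=\lim_m5^m\big(u(F_0^mq_1)-u(F_0^mq_2)\big)$. Green's function: $G(x,y)$ is the continuous symmetric kernel on $SG\times SG$ such that for every continuous $f$ the unique solution of $-\Delta u=f$, $u|_{V_0}=0$ is $u(x)=\int_{SG}G(x,y)f(y)\,d\mu(y)$.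 The antisymmetric monomial $P_{j3}$ ($j\ge0$) is the unique function with $\Delta^{j+1}P_{j3}=0$ and, for $0\le m\le j$, $\Delta^mP_{j3}(q_0)=0$, $\partial_n\Delta^mP_{j3}(q_0)=0$, $\partial_T\Delta^mP_{j3}(q_0)=\delta_{m,j}$. (One has $\gamma_0=P_{03}(q_1)=1/2$.) Gram–Schmidt: $p_0=P_{03}$ and $p_j=P_{j3}-\sum_{l=0}^{j-1}d_l^2\langle P_{j3},p_l\rangle p_l$ for $j\ge1$, where $d_l>0$ and $d_l^{-2}=\|p_l\|_{L^2}^2$. *)

theory Defs
  imports
    "HOL-Analysis.Analysis"
    "HOL-Probability.Probability_Measure"
    "Jordan_Normal_Form.Matrix"
begin

text \<open>The three vertices are given as a family \<open>q\<close> indexed by the three-element type \<open>3\<close>, whose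
  elements are \<open>0\<close>, \<open>1\<close>, \<open>2\<close>; words over \<open>{0, 1, 2}\<close> are lists over this type.\<close>

definition equilateral :: "(3 \<Rightarrow> real^2) \<Rightarrow> bool" where
  "equilateral q \<longleftrightarrow> (\<exists>s>0. \<forall>i j. i \<noteq> j \<longrightarrow> dist (q i) (q j) = s)"

definition F :: "(3 \<Rightarrow> real^2) \<Rightarrow> 3 \<Rightarrow> real^2 \<Rightarrow> real^2" where
  "F q i x = (1/2) *\<^sub>R (x - q i) + q i"

definition SG :: "(3 \<Rightarrow> real^2) \<Rightarrow> (real^2) set" where
  "SG q = (THE K. K \<noteq> {} \<and> compact K \<and> K = (\<Union>i. F q i ` K))"

lemma gasket_ex:
  "\<exists>K. K \<noteq> {} \<and> compact K \<and> K = (\<Union>i. F q i ` K)"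
proof -
  define T where "T K = (\<Union>i. F q i ` K)" for K
  define R where "R = Max (range (\<lambda>i. norm (q i)))"
  have R: "norm (q i) \<le> R" for i
    unfolding R_def by (rule Max_ge) auto
  define B where "B = cball (0::real^2) R"
  have "0 \<le> R" using R[of 0] norm_ge_zero[of "q 0"] by linarith
  then have B: "B \<noteq> {}" "compact B" by (auto simp: B_def)
  have mono: "T K \<subseteq> T L" if "K \<subseteq> L" for K L
    using that unfolding T_def by blast
  have TB: "T B \<subseteq> B"
  proof
    fix z assume "z \<in> T B"
    then obtain i x where x: "norm x \<le> R" and z: "z = F q i x"
      by (auto simp: T_def B_def)
    have "z = (1/2) *\<^sub>R x + (1/2) *\<^sub>R q i"
      unfolding z F_def by (simp add: scaleR_right_diff_distrib)
    then have "norm z \<le> norm ((1/2) *\<^sub>R x) + norm ((1/2) *\<^sub>R q i)"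
      using norm_triangle_ineq by metis
    also have "\<dots> \<le> R" using x R[of i] by simp
    finally show "z \<in> B" by (simp add: B_def)
  qed
  define K where "K n = (T ^^ n) B" for n
  have KS: "K (Suc n) = T (K n)" for n by (simp add: K_def)
  have cont: "continuous_on A (F q i)" for A i
    unfolding F_def by (intro continuous_intros)
  have Kc: "K n \<noteq> {} \<and> compact (K n)" for n
  proof (induction n)
    case 0 then show ?case using B by (simp add: K_def)
  next
    case (Suc n)
    then show ?case unfolding KS T_def
      by (auto intro!: compact_UN compact_continuous_image cont)
  qed
  have Kd: "K (Suc n) \<subseteq> K n" for n
  proof (induction n)
    case 0 then show ?case using TB by (simp add: K_def)
  next
    case (Suc n) then show ?case unfolding KS by (intro mono) (simp add: KS)
  qed
  then have dec: "K n \<subseteq> K m" if "m \<le> n" for m n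
    using that by (rule lift_Suc_antimono_le)
  define S where "S = (\<Inter>n. K n)"
  have "S \<noteq> {}" unfolding S_def using Kc dec by (intro compact_nest) auto
  moreover have "compact S" unfolding S_def using Kc by (intro compact_Inter) auto
  moreover have "T S \<subseteq> S"
  proof -
    have "T S \<subseteq> K n" for n
    proof -
      have "T S \<subseteq> K (Suc n)" unfolding KS by (intro mono) (auto simp: S_def)
      then show ?thesis using Kd by blast
    qed
    then show ?thesis unfolding S_def by blast
  qed
  moreover have "S \<subseteq> T S"
  proof
    fix x assume x: "x \<in> S"
    have "\<forall>n. \<exists>i. 2 *\<^sub>R x - q i \<in> K n"
    proof
      fix n
      from x have "x \<in> T (K n)" unfolding S_def using KS by blast
      then obtain i y where y: "y \<in> K n" "x = F q i y" by (auto simp: T_def)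
      then have "2 *\<^sub>R x - q i = y"
        by (simp add: F_def scaleR_right_distrib scaleR_2)
      with y show "\<exists>i. 2 *\<^sub>R x - q i \<in> K n" by metis
    qed
    then obtain h where h: "\<And>n. 2 *\<^sub>R x - q (h n) \<in> K n" by metis
    have "\<exists>i. infinite {n. h n = i}"
    proof (rule ccontr)
      assume "\<not> ?thesis"
      then have "finite (\<Union>i. {n. h n = i})" by (intro finite_UN_I) auto
      moreover have "(\<Union>i. {n. h n = i}) = UNIV" by auto
      ultimately show False by simp
    qed
    then obtain i where i: "infinite {n. h n = i}" by blast
    have "2 *\<^sub>R x - q i \<in> K n" for n
    proof -
      obtain m where "m \<ge> n" "h m = i" using i by (auto simp: infinite_nat_iff_unbounded_le)
      then show ?thesis using h[of m] dec by blast
    qed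
    then have "2 *\<^sub>R x - q i \<in> S" by (simp add: S_def)
    moreover have "x = F q i (2 *\<^sub>R x - q i)" by (simp add: F_def scaleR_right_diff_distrib scaleR_2 flip: scaleR_left_distrib)
    ultimately show "x \<in> T S" unfolding T_def by blast
  qed
  ultimately show ?thesis unfolding T_def by blast
qed

lemma gasket_subset:
  assumes K: "compact K" "K \<subseteq> (\<Union>i. F q i ` K)"
    and L: "L \<noteq> {}" "compact L" "(\<Union>i. F q i ` L) \<subseteq> L"
  shows "K \<subseteq> L"
proof (cases "K = {}")
  case False
  have "continuous_on K (\<lambda>x. infdist x L)" by (intro continuous_intros)
  then obtain x where x: "x \<in> K" "\<And>y. y \<in> K \<Longrightarrow> infdist y L \<le> infdist x L"
    using continuous_attains_sup[OF K(1) False] by blast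
  obtain i y where y: "y \<in> K" "x = F q i y" using x(1) K(2) by blast
  obtain z where z: "z \<in> L" "infdist y L = dist y z"
    using infdist_attains_inf[OF compact_imp_closed[OF L(2)] L(1)] by blast
  have "F q i z \<in> L" using z(1) L(3) by blast
  then have "infdist x L \<le> dist x (F q i z)" by (rule infdist_le)
  also have "x - F q i z = (1/2) *\<^sub>R (y - z)"
    unfolding y(2) F_def by (simp add: scaleR_right_diff_distrib)
  then have "dist x (F q i z) = infdist y L / 2"
    unfolding z(2) dist_norm by simp
  finally have "infdist x L \<le> 0" using x(2)[OF y(1)] by linarith
  then have "infdist w L = 0" if "w \<in> K" for w
    using x(2)[OF that] infdist_nonneg[of w L] by linarith
  then show ?thesis
    using in_closed_iff_infdist_zero[OF compact_imp_closed[OF L(2)] L(1)] by blast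
qed simp

lemma gasket_unique:
  "\<exists>!K. K \<noteq> {} \<and> compact K \<and> K = (\<Union>i. F q i ` K)"
proof (rule ex_ex1I[OF gasket_ex])
  fix K L
  assume K: "K \<noteq> {} \<and> compact K \<and> K = (\<Union>i. F q i ` K)"
    and L: "L \<noteq> {} \<and> compact L \<and> L = (\<Union>i. F q i ` L)"
  have "K \<subseteq> L" by (rule gasket_subset[of _ q]) (use K L in auto)
  moreover have "L \<subseteq> K" by (rule gasket_subset[of _ q]) (use K L in auto)
  ultimately show "K = L" by blast
qed

lemma SG_nonempty: "SG q \<noteq> {}"
  and SG_compact: "compact (SG q)"
  and SG_self_similar: "SG q = (\<Union>i. F q i ` SG q)"
  using theI'[OF gasket_unique, of q] unfolding SG_def by blast+

definition F_word :: "(3 \<Rightarrow> real^2) \<Rightarrow> 3 list \<Rightarrow> real^2 \<Rightarrow> real^2" where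
  "F_word q w = foldr (\<lambda>i g. F q i \<circ> g) w id"

definition cell :: "(3 \<Rightarrow> real^2) \<Rightarrow> 3 list \<Rightarrow> (real^2) set" where
  "cell q w = F_word q w ` SG q"

primrec V :: "(3 \<Rightarrow> real^2) \<Rightarrow> nat \<Rightarrow> (real^2) set" where
  "V q 0 = range q"
| "V q (Suc m) = (\<Union>i. F q i ` V q m)"

definition neighbours :: "(3 \<Rightarrow> real^2) \<Rightarrow> nat \<Rightarrow> real^2 \<Rightarrow> (real^2) set" where
  "neighbours q m x =
     {y \<in> V q m. y \<noteq> x \<and> (\<exists>w. length w = m \<and> x \<in> cell q w \<and> y \<in> cell q w)}"

definition gasket_measure :: "(3 \<Rightarrow> real^2) \<Rightarrow> (real^2) measure \<Rightarrow> bool" where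
  "gasket_measure q \<mu> \<longleftrightarrow>
     prob_space \<mu> \<and> sets \<mu> = sets (restrict_space borel (SG q)) \<and>
     (\<forall>w. measure \<mu> (cell q w) = 1 / 3 ^ length w)"

definition L2_inner :: "(real^2) measure \<Rightarrow> (real^2 \<Rightarrow> real) \<Rightarrow> (real^2 \<Rightarrow> real) \<Rightarrow> real" where
  "L2_inner \<mu> f g = (LINT x|\<mu>. f x * g x)"

definition L2_norm :: "(real^2) measure \<Rightarrow> (real^2 \<Rightarrow> real) \<Rightarrow> real" where
  "L2_norm \<mu> f = sqrt (L2_inner \<mu> f f)"

text \<open>Functions on the gasket are represented by functions on the plane of which only the values
  on \<open>SG q\<close> matter.  The level-\<open>m\<close> difference quotient makes sense only at points of level \<open>m\<close>, so
  uniform convergence on \<open>V\<^sub>* - V\<^sub>0\<close> means that the error at level \<open>m\<close> is small at all points of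
  \<open>V\<^sub>m - V\<^sub>0\<close> simultaneously; each point of \<open>V\<^sub>*\<close> lies in \<open>V\<^sub>m\<close> for all large \<open>m\<close>.\<close>

definition level_laplacian ::
    "(3 \<Rightarrow> real^2) \<Rightarrow> nat \<Rightarrow> (real^2 \<Rightarrow> real) \<Rightarrow> real^2 \<Rightarrow> real" where
  "level_laplacian q m u x = 3/2 * 5 ^ m * (\<Sum>y\<in>neighbours q m x. u y - u x)"

definition has_laplacian ::
    "(3 \<Rightarrow> real^2) \<Rightarrow> (real^2 \<Rightarrow> real) \<Rightarrow> (real^2 \<Rightarrow> real) \<Rightarrow> bool" where
  "has_laplacian q u f \<longleftrightarrow>
     continuous_on (SG q) u \<and> continuous_on (SG q) f \<and>
     (\<forall>\<epsilon>>0. \<exists>N. \<forall>m\<ge>N. \<forall>x\<in>V q m - V q 0. \<bar>level_laplacian q m u x - f x\<bar> < \<epsilon>)"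

definition has_normal_derivative_q0 ::
    "(3 \<Rightarrow> real^2) \<Rightarrow> (real^2 \<Rightarrow> real) \<Rightarrow> real \<Rightarrow> bool" where
  "has_normal_derivative_q0 q u D \<longleftrightarrow>
     (\<lambda>m. (5/3) ^ m * (2 * u (q 0) - u ((F q 0 ^^ m) (q 1)) - u ((F q 0 ^^ m) (q 2))))
       \<longlonglongrightarrow> D"

definition has_tangential_derivative_q0 ::
    "(3 \<Rightarrow> real^2) \<Rightarrow> (real^2 \<Rightarrow> real) \<Rightarrow> real \<Rightarrow> bool" where
  "has_tangential_derivative_q0 q u D \<longleftrightarrow>
     (\<lambda>m. 5 ^ m * (u ((F q 0 ^^ m) (q 1)) - u ((F q 0 ^^ m) (q 2)))) \<longlonglongrightarrow> D"

definition green_function ::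
    "(3 \<Rightarrow> real^2) \<Rightarrow> (real^2) measure \<Rightarrow> (real^2 \<Rightarrow> real^2 \<Rightarrow> real) \<Rightarrow> bool" where
  "green_function q \<mu> G \<longleftrightarrow>
     continuous_on (SG q \<times> SG q) (\<lambda>(x, y). G x y) \<and>
     (\<forall>x\<in>SG q. \<forall>y\<in>SG q. G x y = G y x) \<and>
     (\<forall>f u. continuous_on (SG q) f \<longrightarrow>
        (has_laplacian q u (\<lambda>x. - f x) \<and> (\<forall>x\<in>V q 0. u x = 0) \<longleftrightarrow>
         (\<forall>x\<in>SG q. u x = (LINT y|\<mu>. G x y * f y))))"

text \<open>In the following definition \<open>v m\<close> is the \<open>m\<close>-th iterated Laplacian of \<open>u\<close>.\<close>

definition antisymmetric_monomial :: "(3 \<Rightarrow> real^2) \<Rightarrow> nat \<Rightarrow> (real^2 \<Rightarrow> real) \<Rightarrow> bool" where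
  "antisymmetric_monomial q j u \<longleftrightarrow>
     (\<exists>v. v 0 = u \<and>
        (\<forall>m\<le>j. has_laplacian q (v m) (v (Suc m))) \<and>
        (\<forall>x\<in>SG q. v (Suc j) x = 0) \<and>
        (\<forall>m\<le>j. v m (q 0) = 0 \<and> has_normal_derivative_q0 q (v m) 0 \<and>
           has_tangential_derivative_q0 q (v m) (if m = j then 1 else 0)))"

fun gram_schmidt ::
    "(real^2) measure \<Rightarrow> (nat \<Rightarrow> real^2 \<Rightarrow> real) \<Rightarrow> nat \<Rightarrow> real^2 \<Rightarrow> real" where
  "gram_schmidt \<mu> P j = (\<lambda>x. P j x -
     (\<Sum>l<j. (1 / L2_norm \<mu> (gram_schmidt \<mu> P l))\<^sup>2 *
        L2_inner \<mu> (P j) (gram_schmidt \<mu> P l) * gram_schmidt \<mu> P l x))"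

declare gram_schmidt.simps [simp del]

end

(* A reflection of the gasket commutes with the Laplacian, and composing with a contraction F_i
   divides it by 5, because two distinct cells of level 1 share only one point.  By the defining
   property of the Green's function a harmonic function is determined by its boundary values, so
   these symmetries give the eigenfunctions of u |-> u o F_0 on harmonic functions (with
   eigenvalues 1/5 and 3/5).  Hence a polyharmonic function whose jet at q_0 vanishes is zero,
   the Laplacian maps P_{j+1} to P_j, and P_j is antisymmetric at q_0.  It follows that
   f_{k+1} = zeta_k P_0 + sum_l omega_{k,l} P_{l+1}.  As the Green operator is symmetric, f_{k+1}
   is orthogonal to p_j for j < k - 1, so f_{k+1} = p_{k+1} + b_k p_k + c_k p_{k-1}; the P_l being
   linearly independent, comparing coefficients gives the recurrence. *)

theory Submission
  imports Defs
begin

text \<open>The Laplacian is given only as a uniform limit, so the only harmonic functions at hand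
  are the constants and what the monomials supply, in effect \<open>P 0\<close>. Its tangential
  derivative 1 makes it nonzero; antisymmetrised it gives the first eigenfunction, and reflections
  of that one give the second. The scalings 5 and 5/3 in the derivatives at q_0 are the inverses of
  the two eigenvalues, so on a harmonic function both difference quotients are independent of the
  level; this is why a vanishing jet forces zero. The number zeta_k comes from the boundary
  condition: sum_l omega_{k,l} P_{l+1} already has Laplacian p_k, vanishes at q_0 and takes opposite
  values at q_1 and q_2, so a single multiple of P_0 repairs both corners. The recurrence is the
  classical three-term recurrence of orthogonal polynomials, with the Green operator, which raises
  the degree by one and keeps the leading coefficient 1, in the role of multiplication by x.\<close>

section \<open>Contractions, vertices and cells\<close>

lemma three_cases: "(k::3) = 0 \<or> k = 1 \<or> k = 2"
  using exhaust_3[of k] by auto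

lemma sum_three: "sum g (UNIV :: 3 set) = g 0 + g 1 + g 2"
  for g :: "3 \<Rightarrow> 'a::comm_monoid_add"
proof -
  have "(UNIV :: 3 set) = {0, 1, 2}" using three_cases by blast
  then have "sum g UNIV = sum g {0, 1, 2}" by (rule arg_cong)
  also have "\<dots> = g 0 + g 1 + g 2" by (simp add: add.assoc)
  finally show ?thesis .
qed

lemma third_index:
  fixes i j :: 3
  assumes "i \<noteq> j"
  obtains k where "k \<noteq> i" "k \<noteq> j" "(UNIV :: 3 set) = {i, j, k}"
proof -
  have "card (UNIV - {i, j}) = CARD(3) - 2"
    using assms by (subst card_Diff_subset) auto
  then obtain k where "UNIV - {i, j} = {k}" by (auto simp: card_1_singleton_iff)
  then show ?thesis by (intro that[of k]) auto
qed

lemma sum_distinct_three: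
  fixes g :: "3 \<Rightarrow> 'a::comm_monoid_add"
  assumes "(UNIV :: 3 set) = {i, j, k}" "i \<noteq> j" "k \<noteq> i" "k \<noteq> j"
  shows "sum g UNIV = g i + g j + g k"
proof -
  have "sum g UNIV = sum g {i, j, k}" using assms(1) by (rule arg_cong)
  also have "\<dots> = g i + g j + g k" using assms(2-4) by (auto simp: add.assoc)
  finally show ?thesis .
qed

lemma F_eq: "F q i x = (1/2) *\<^sub>R (x + q i)"
  by (simp add: F_def algebra_simps flip: scaleR_left_distrib)

lemma F_vertex [simp]: "F q i (q i) = q i"
  by (simp add: F_def)

lemma F_commute: "F q i (q j) = F q j (q i)"
  by (simp add: F_eq add.commute)

lemma F_inject [simp]: "F q i x = F q i y \<longleftrightarrow> x = y"
  by (simp add: F_eq)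

lemma continuous_on_F [continuous_intros]: "continuous_on A (F q i)"
  unfolding F_def by (intro continuous_intros)

lemma F_in_SG [simp, intro]: "x \<in> SG q \<Longrightarrow> F q i x \<in> SG q"
  by (subst SG_self_similar) blast

text \<open>Serves as an induction principle for closed properties: it suffices to check one point
  and stability under the three maps.\<close>

lemma SG_subset_invariant:
  assumes "L \<noteq> {}" "compact L" "\<And>i x. x \<in> L \<Longrightarrow> F q i x \<in> L"
  shows "SG q \<subseteq> L"
  using SG_compact equalityD1[OF SG_self_similar] assms(1,2)
  by (rule gasket_subset) (use assms(3) in blast)

lemma funpow_F_in_SG [intro]: "x \<in> SG q \<Longrightarrow> (F q i ^^ m) x \<in> SG q"
  by (induction m) auto

text \<open>A vertex is fixed by its own map, so the singleton is covered by its images, which is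
  all that \<open>gasket_subset\<close> asks of the smaller set.\<close>

lemma vertex_in_SG [simp, intro]: "q i \<in> SG q"
proof -
  have "{q i} \<subseteq> SG q"
  proof (rule gasket_subset[of _ q])
    show "{q i} \<subseteq> (\<Union>j. F q j ` {q i})" by (auto intro: exI[of _ i])
    show "(\<Union>j. F q j ` SG q) \<subseteq> SG q" by auto
  qed (simp_all add: SG_nonempty SG_compact)
  then show ?thesis by simp
qed

lemma V_subset_SG: "V q m \<subseteq> SG q"
  by (induction m) auto

lemma V_mono_Suc: "V q m \<subseteq> V q (Suc m)"
proof (induction m)
  case 0
  show ?case
  proof
    fix x assume "x \<in> V q 0"
    then obtain i where "x = F q i (q i)" by auto
    then show "x \<in> V q (Suc 0)" by (simp only: V.simps) blast
  qed
next
  case (Suc m)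
  then show ?case by (subst (1 2) V.simps(2)) (intro UN_mono image_mono order_refl)
qed

lemma vertex_in_V [simp, intro]: "q i \<in> V q m"
  by (induction m) (use V_mono_Suc in fastforce)+

lemma cell_Nil [simp]: "cell q [] = SG q"
  by (simp add: cell_def F_word_def)

lemma cell_Cons [simp]: "cell q (i # w) = F q i ` cell q w"
  by (simp add: cell_def F_word_def image_comp)

lemma cell_subset_SG: "cell q w \<subseteq> SG q"
  by (induction w) auto

lemma neighbours_subset_V: "neighbours q m x \<subseteq> V q m"
  by (auto simp: neighbours_def)

lemma neighbours_in_SG: "y \<in> neighbours q m x \<Longrightarrow> y \<in> SG q"
  using neighbours_subset_V V_subset_SG by blast

section \<open>Linearity of the Laplacian\<close>

text \<open>Difference quotients at points of \<open>V q m\<close> sample only points of the gasket,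
  so functions on the plane may be exchanged freely outside it.\<close>

lemma has_laplacian_cong:
  assumes "has_laplacian q u f"
    and "\<And>x. x \<in> SG q \<Longrightarrow> u' x = u x" "\<And>x. x \<in> SG q \<Longrightarrow> f' x = f x"
  shows "has_laplacian q u' f'"
proof -
  have "level_laplacian q m u' x = level_laplacian q m u x" if "x \<in> V q m" for m x
  proof -
    have "u' x = u x" using that assms(2) V_subset_SG by blast
    then show ?thesis
      unfolding level_laplacian_def
      by (auto intro!: sum.cong assms(2) dest: neighbours_in_SG)
  qed
  moreover have "f' x = f x" if "x \<in> V q m" for m x
    using that assms(3) V_subset_SG by blast
  ultimately have "(\<forall>x\<in>V q m - V q 0. \<bar>level_laplacian q m u' x - f' x\<bar> < \<epsilon>) \<longleftrightarrow>
      (\<forall>x\<in>V q m - V q 0. \<bar>level_laplacian q m u x - f x\<bar> < \<epsilon>)" for m \<epsilon>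
    by (intro ball_cong refl) (metis DiffD1)
  then show ?thesis
    using assms unfolding has_laplacian_def by (simp cong: continuous_on_cong del: V.simps)
qed

lemma has_laplacian_add:
  assumes "has_laplacian q u f" "has_laplacian q v g"
  shows "has_laplacian q (\<lambda>x. u x + v x) (\<lambda>x. f x + g x)"
  unfolding has_laplacian_def
proof (intro conjI allI impI)
  show "continuous_on (SG q) (\<lambda>x. u x + v x)" "continuous_on (SG q) (\<lambda>x. f x + g x)"
    using assms by (auto simp: has_laplacian_def intro!: continuous_intros)
next
  fix \<epsilon> :: real assume "0 < \<epsilon>"
  then have \<epsilon>: "0 < \<epsilon> / 2" by simp
  from assms(1) \<epsilon> obtain N1 where N1:
    "\<And>m x. m \<ge> N1 \<Longrightarrow> x \<in> V q m - V q 0 \<Longrightarrow> \<bar>level_laplacian q m u x - f x\<bar> < \<epsilon> / 2"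
    unfolding has_laplacian_def by meson
  from assms(2) \<epsilon> obtain N2 where N2:
    "\<And>m x. m \<ge> N2 \<Longrightarrow> x \<in> V q m - V q 0 \<Longrightarrow> \<bar>level_laplacian q m v x - g x\<bar> < \<epsilon> / 2"
    unfolding has_laplacian_def by meson
  have L: "level_laplacian q m (\<lambda>x. u x + v x) x = level_laplacian q m u x + level_laplacian q m v x" for m x
    unfolding level_laplacian_def by (simp add: add_diff_add sum.distrib distrib_left)
  show "\<exists>N. \<forall>m\<ge>N. \<forall>x\<in>V q m - V q 0.
      \<bar>level_laplacian q m (\<lambda>x. u x + v x) x - (f x + g x)\<bar> < \<epsilon>"
  proof (intro exI[of _ "max N1 N2"] allI impI ballI)
    fix m x assume "max N1 N2 \<le> m" "x \<in> V q m - V q 0"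
    with N1[of m x] N2[of m x]
    show "\<bar>level_laplacian q m (\<lambda>x. u x + v x) x - (f x + g x)\<bar> < \<epsilon>"
      unfolding L by (simp del: V.simps, argo)
  qed
qed

lemma has_laplacian_scale:
  assumes "has_laplacian q u f"
  shows "has_laplacian q (\<lambda>x. c * u x) (\<lambda>x. c * f x)"
  unfolding has_laplacian_def
proof (intro conjI allI impI)
  show "continuous_on (SG q) (\<lambda>x. c * u x)" "continuous_on (SG q) (\<lambda>x. c * f x)"
    using assms by (auto simp: has_laplacian_def intro!: continuous_intros)
next
  fix \<epsilon> :: real assume "0 < \<epsilon>"
  then have \<epsilon>: "0 < \<epsilon> / (\<bar>c\<bar> + 1)" by (auto intro!: divide_pos_pos)
  with assms obtain N where N:
    "\<And>m x. m \<ge> N \<Longrightarrow> x \<in> V q m - V q 0 \<Longrightarrow>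
      \<bar>level_laplacian q m u x - f x\<bar> < \<epsilon> / (\<bar>c\<bar> + 1)"
    unfolding has_laplacian_def by meson
  have L: "level_laplacian q m (\<lambda>x. c * u x) x = c * level_laplacian q m u x" for m x
    unfolding level_laplacian_def
    by (simp add: sum_distrib_left right_diff_distrib mult.left_commute)
  show "\<exists>N. \<forall>m\<ge>N. \<forall>x\<in>V q m - V q 0.
      \<bar>level_laplacian q m (\<lambda>x. c * u x) x - c * f x\<bar> < \<epsilon>"
  proof (intro exI[of _ N] allI impI ballI)
    fix m x assume "N \<le> m" "x \<in> V q m - V q 0"
    then have "\<bar>level_laplacian q m u x - f x\<bar> * (\<bar>c\<bar> + 1) < \<epsilon>"
      using N[of m x] by (simp add: pos_less_divide_eq)
    moreover have "\<bar>level_laplacian q m (\<lambda>x. c * u x) x - c * f x\<bar>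
        = \<bar>level_laplacian q m u x - f x\<bar> * \<bar>c\<bar>"
      unfolding L by (simp flip: right_diff_distrib add: abs_mult)
    ultimately show "\<bar>level_laplacian q m (\<lambda>x. c * u x) x - c * f x\<bar> < \<epsilon>"
      by (simp add: distrib_left)
  qed
qed

lemma has_laplacian_diff:
  assumes "has_laplacian q u f" "has_laplacian q v g"
  shows "has_laplacian q (\<lambda>x. u x - v x) (\<lambda>x. f x - g x)"
  using has_laplacian_add[OF assms(1) has_laplacian_scale[OF assms(2), of "-1"]] by simp

lemma has_laplacian_const: "has_laplacian q (\<lambda>x. c) (\<lambda>x. 0)"
  unfolding has_laplacian_def level_laplacian_def by simp

lemma has_laplacian_sum:
  assumes "\<And>l. l \<in> I \<Longrightarrow> has_laplacian q (u l) (f l)"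
  shows "has_laplacian q (\<lambda>x. \<Sum>l\<in>I. a l * u l x) (\<lambda>x. \<Sum>l\<in>I. a l * f l x)"
  using assms
proof (induction I rule: infinite_finite_induct)
  case (insert i I)
  then show ?case
    using has_laplacian_add[OF has_laplacian_scale] by simp
qed (simp_all add: has_laplacian_const)

lemma has_laplacian_continuous:
  "has_laplacian q u f \<Longrightarrow> continuous_on (SG q) u"
  "has_laplacian q u f \<Longrightarrow> continuous_on (SG q) f"
  by (simp_all add: has_laplacian_def)

section \<open>Barycentric coordinates and intersections of cells\<close>

locale gasket =
  fixes q :: "3 \<Rightarrow> real^2"
  assumes equilateral: "equilateral q"
begin

text \<open>The barycentric coordinate belonging to \<open>q i\<close>. The vector in the inner
  product points along the altitude through \<open>q i\<close>; for side length s its product with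
  \<open>q j - q i\<close> is -3/2 s^2 for each other vertex, which explains the factor 2/3 and the
  division by the squared side.\<close>

definition bary :: "3 \<Rightarrow> real^2 \<Rightarrow> real" where
  "bary i x = 1 + 2 / 3 * ((x - q i) \<bullet> (3 *\<^sub>R q i - (\<Sum>j\<in>UNIV. q j))) / (dist (q 0) (q 1))\<^sup>2"

lemma bary_midpoint: "bary i ((1/2) *\<^sub>R (x + y)) = (bary i x + bary i y) / 2"
proof -
  have "(1/2) *\<^sub>R (x + y) - q i = (1/2) *\<^sub>R (x - q i) + (1/2) *\<^sub>R (y - q i)"
    by (simp add: algebra_simps flip: scaleR_left_distrib)
  then show ?thesis
    unfolding bary_def by (simp add: inner_add_left add_divide_distrib distrib_left)
qed

lemma bary_vertex: "bary i (q j) = (if i = j then 1 else 0)"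
proof -
  obtain s where s: "s > 0" "\<And>i j. i \<noteq> j \<Longrightarrow> dist (q i) (q j) = s"
    using equilateral unfolding equilateral_def by blast
  have n: "(q i - q j) \<bullet> (q i - q j) = (if i = j then 0 else s\<^sup>2)" for i j
    using s(2)[of i j] by (auto simp: dist_norm power2_norm_eq_inner)
  have "(q j - q i) \<bullet> (3 *\<^sub>R q i - (\<Sum>j\<in>UNIV. q j)) = - 3/2 * s\<^sup>2" if ij: "i \<noteq> j"
  proof -
    obtain k where UN: "k \<noteq> i" "k \<noteq> j" "(UNIV :: 3 set) = {i, j, k}"
      using third_index[OF ij] by metis
    then have k: "k \<noteq> i" "k \<noteq> j" "(\<Sum>j\<in>UNIV. q j) = q i + q j + q k"
      using ij by (auto intro: sum_distinct_three)
    show ?thesis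
      using n[of i j] n[of i k] n[of j k] ij k(1,2) unfolding k(3)
      by (simp add: inner_diff_left inner_diff_right inner_add_left inner_add_right inner_commute)
  qed
  moreover have "dist (q 0) (q 1) = s" by (rule s(2)) simp
  ultimately show ?thesis using s(1) by (simp add: bary_def)
qed

lemma bary_F: "bary i (F q j x) = (bary i x + (if i = j then 1 else 0)) / 2"
  by (simp add: F_eq bary_midpoint bary_vertex)

lemma vertex_inject [simp]: "q i = q j \<longleftrightarrow> i = j"
  using bary_vertex[of i j] bary_vertex[of i i] by (auto split: if_splits)

lemma continuous_on_bary [continuous_intros]: "continuous_on A (bary i)"
  unfolding bary_def by (intro continuous_intros) auto

text \<open>The points with all three properties form a nonempty compact set that every
  \<open>F q i\<close> maps into itself. Reconstruction from the coordinates belongs to the set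
  because it yields boundedness: its points are convex combinations of the vertices.\<close>

lemma SG_bary:
  assumes "x \<in> SG q"
  shows "bary i x \<ge> 0" "(\<Sum>i\<in>UNIV. bary i x) = 1" "(\<Sum>i\<in>UNIV. bary i x *\<^sub>R q i) = x"
proof -
  define L where "L = {x. (\<forall>i. bary i x \<ge> 0) \<and> (\<Sum>i\<in>UNIV. bary i x) = 1
    \<and> (\<Sum>i\<in>UNIV. bary i x *\<^sub>R q i) = x}"
  have "closed L"
    unfolding L_def by (intro closed_Collect_conj closed_Collect_all closed_Collect_le
        closed_Collect_eq continuous_intros)
  moreover have "bounded L"
    unfolding bounded_iff
  proof (intro exI ballI)
    fix x assume x: "x \<in> L"
    have le: "bary i x \<le> 1" for i
    proof -
      have "bary i x \<le> (\<Sum>i\<in>UNIV. bary i x)"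
        by (rule member_le_sum) (use x in \<open>auto simp: L_def\<close>)
      then show ?thesis using x by (simp add: L_def)
    qed
    have "norm x = norm (\<Sum>i\<in>UNIV. bary i x *\<^sub>R q i)" using x by (simp add: L_def)
    also have "\<dots> \<le> (\<Sum>i\<in>UNIV. norm (q i))"
      by (rule sum_norm_le) (use x le in \<open>auto simp: L_def intro: mult_left_le_one_le\<close>)
    finally show "norm x \<le> (\<Sum>i\<in>UNIV. norm (q i))" .
  qed
  ultimately have "compact L" by (simp add: compact_eq_bounded_closed)
  moreover have "q 0 \<in> L"
    using three_cases by (auto simp: L_def bary_vertex sum_three)
  moreover have "F q i x \<in> L" if "x \<in> L" for i x
  proof -
    have "(\<Sum>k\<in>UNIV. bary k (F q i x) *\<^sub>R q k)
        = (1/2) *\<^sub>R ((\<Sum>k\<in>UNIV. bary k x *\<^sub>R q k) + q i)"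
      using three_cases[of i] by (auto simp: bary_F sum_three algebra_simps add_divide_distrib)
    moreover have "(\<Sum>k\<in>UNIV. bary k (F q i x)) = ((\<Sum>k\<in>UNIV. bary k x) + 1) / 2"
      using three_cases[of i] by (auto simp: bary_F sum_three)
    ultimately show ?thesis
      using that by (simp add: L_def bary_F) (simp add: F_eq)
  qed
  ultimately have "SG q \<subseteq> L"
    by (intro SG_subset_invariant) auto
  with assms show "bary i x \<ge> 0" "(\<Sum>i\<in>UNIV. bary i x) = 1" "(\<Sum>i\<in>UNIV. bary i x *\<^sub>R q i) = x"
    by (auto simp: L_def)
qed

lemma SG_eqI:
  assumes "x \<in> SG q" "y \<in> SG q" "\<And>i. bary i x = bary i y"
  shows "x = y"
proof -
  have "(\<Sum>i\<in>UNIV. bary i x *\<^sub>R q i) = (\<Sum>i\<in>UNIV. bary i y *\<^sub>R q i)"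
    by (simp only: assms(3))
  then show ?thesis using SG_bary(3) assms(1,2) by metis
qed

text \<open>Comparing coordinates gives \<open>bary i x + 1 = bary i y\<close> and
  \<open>bary j x = bary j y + 1\<close>. All coordinates lie between 0 and 1, so
  \<open>bary i x = 0\<close> and \<open>bary j x = 1\<close>, and these are the coordinates of
  \<open>q j\<close>.\<close>

lemma F_inter:
  assumes x: "x \<in> SG q" and y: "y \<in> SG q" and eq: "F q i x = F q j y" and "i \<noteq> j"
  shows "x = q j"
proof -
  obtain k where k: "k \<noteq> i" "k \<noteq> j" "(UNIV :: 3 set) = {i, j, k}"
    using third_index[OF \<open>i \<noteq> j\<close>] by metis
  then have UN: "l = i \<or> l = j \<or> l = k" "k \<noteq> i" "k \<noteq> j" for l
    by auto
  have sum: "sum g UNIV = g i + g j + g k" for g :: "3 \<Rightarrow> real"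
    using k \<open>i \<noteq> j\<close> by (intro sum_distinct_three) auto
  have "bary i (F q i x) = bary i (F q j y)" "bary j (F q i x) = bary j (F q j y)"
    "bary k (F q i x) = bary k (F q j y)"
    using eq by simp_all
  then have *: "bary i x + 1 = bary i y" "bary j x = bary j y + 1" "bary k x = bary k y"
    using \<open>i \<noteq> j\<close> UN(2,3) by (simp_all add: bary_F)
  have "bary i y \<le> 1"
    using SG_bary(1)[OF y, of j] SG_bary(1)[OF y, of k] SG_bary(2)[OF y] unfolding sum by linarith
  then have "bary i x = 0" "bary j x = 1" "bary k x = 0"
    using * SG_bary(1)[OF x, of i] SG_bary(1)[OF x, of k] SG_bary(1)[OF y, of j] SG_bary(2)[OF x]
    unfolding sum by linarith+
  then have "bary l x = bary l (q j)" for l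
    using UN(1)[of l] UN(2,3) \<open>i \<noteq> j\<close> by (auto simp: bary_vertex)
  then show ?thesis using x by (intro SG_eqI) auto
qed

section \<open>Contractions and the Laplacian\<close>

lemma F_eq_vertexD:
  assumes "x \<in> SG q" "F q i x = q j"
  shows "x = q j"
  using assms F_inter[of x "q j" i j] F_inject[of q i x "q i"] by (cases "i = j") auto

lemma F_notin_V0:
  assumes "x \<in> SG q" "x \<notin> V q 0"
  shows "F q i x \<notin> V q 0"
proof
  assume "F q i x \<in> V q 0"
  then obtain j where "F q i x = q j" by auto
  then have "x = q j" by (rule F_eq_vertexD[OF assms(1)])
  with assms(2) show False by simp
qed

lemma F_in_V_iff:
  assumes "x \<in> SG q"
  shows "F q i x \<in> V q (Suc m) \<longleftrightarrow> x \<in> V q m"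
proof
  assume "F q i x \<in> V q (Suc m)"
  then obtain j z where z: "z \<in> V q m" "F q i x = F q j z" by auto
  show "x \<in> V q m"
  proof (cases "i = j")
    case False
    then have "x = q j" using F_inter assms z V_subset_SG by blast
    then show ?thesis by auto
  qed (use z in auto)
qed auto

lemma F_in_cell_iff:
  assumes "x \<in> SG q" "x \<notin> V q 0"
  shows "F q i x \<in> cell q (j # w) \<longleftrightarrow> i = j \<and> x \<in> cell q w"
proof
  assume "F q i x \<in> cell q (j # w)"
  then obtain z where z: "z \<in> cell q w" "F q i x = F q j z" by auto
  have "i = j"
    using F_inter[OF assms(1) _ z(2)] assms(2) z(1) cell_subset_SG by auto
  with z show "i = j \<and> x \<in> cell q w" by auto
qed auto

text \<open>Away from the corners, \<open>F q i x\<close> is not a junction of level-1 cells, so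
  each small cell that contains it has a word starting with \<open>i\<close>. At a corner
  \<open>q j\<close> with \<open>j \<noteq> i\<close> there would be further neighbours in the
  adjacent level-1 cell.\<close>

lemma neighbours_F:
  assumes "x \<in> V q m - V q 0"
  shows "neighbours q (Suc m) (F q i x) = F q i ` neighbours q m x"
proof -
  have x: "x \<in> SG q" "x \<notin> V q 0" using assms V_subset_SG by auto
  show ?thesis
  proof (intro equalityI subsetI)
    fix y assume "y \<in> neighbours q (Suc m) (F q i x)"
    then obtain w where w: "y \<in> V q (Suc m)" "y \<noteq> F q i x" "length w = Suc m"
      "F q i x \<in> cell q w" "y \<in> cell q w"
      by (auto simp: neighbours_def)
    then obtain j w' where w': "w = j # w'" "length w' = m" by (auto simp: length_Suc_conv)
    then have "i = j" "x \<in> cell q w'" using w F_in_cell_iff[OF x] by blast+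
    moreover obtain z where z: "z \<in> cell q w'" "y = F q i z" using w w' \<open>i = j\<close> by auto
    moreover have "z \<in> V q m" using w(1) z cell_subset_SG F_in_V_iff by blast
    ultimately show "y \<in> F q i ` neighbours q m x"
      using w' w(2) by (auto simp: neighbours_def)
  next
    fix y assume "y \<in> F q i ` neighbours q m x"
    then obtain z w where z: "y = F q i z" "z \<in> V q m" "z \<noteq> x" "length w = m"
        "x \<in> cell q w" "z \<in> cell q w"
      by (auto simp: neighbours_def)
    then have "length (i # w) = Suc m \<and> F q i x \<in> cell q (i # w) \<and> y \<in> cell q (i # w)"
      by auto
    then show "y \<in> neighbours q (Suc m) (F q i x)"
      unfolding neighbours_def using z(1-3) by (auto intro: exI[of _ "i # w"])
  qed
qed

text \<open>Level \<open>m\<close> of the composed function is level \<open>m + 1\<close> of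
  \<open>u\<close>, whose renormalisation carries one more factor 5.\<close>

lemma has_laplacian_F:
  assumes "has_laplacian q u f"
  shows "has_laplacian q (\<lambda>x. u (F q i x)) (\<lambda>x. f (F q i x) / 5)"
  unfolding has_laplacian_def
proof (intro conjI allI impI)
  show "continuous_on (SG q) (\<lambda>x. u (F q i x))" "continuous_on (SG q) (\<lambda>x. f (F q i x) / 5)"
    using assms unfolding has_laplacian_def
    by (auto intro!: continuous_on_compose2[of "SG q" _ _ "F q i"] continuous_intros)
next
  fix \<epsilon> :: real assume "0 < \<epsilon>"
  with assms obtain N where N:
    "\<And>m x. m \<ge> N \<Longrightarrow> x \<in> V q m - V q 0 \<Longrightarrow> \<bar>level_laplacian q m u x - f x\<bar> < \<epsilon>"
    unfolding has_laplacian_def by meson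
  show "\<exists>N. \<forall>m\<ge>N. \<forall>x\<in>V q m - V q 0.
      \<bar>level_laplacian q m (\<lambda>x. u (F q i x)) x - f (F q i x) / 5\<bar> < \<epsilon>"
  proof (intro exI[of _ N] allI impI ballI)
    fix m x assume m: "N \<le> m" and x: "x \<in> V q m - V q 0"
    have "level_laplacian q (Suc m) u (F q i x)
        = 5 * level_laplacian q m (\<lambda>x. u (F q i x)) x"
      unfolding level_laplacian_def neighbours_F[OF x]
      by (subst sum.reindex) (auto simp: inj_on_def)
    moreover have "F q i x \<in> V q (Suc m) - V q 0"
      using x F_notin_V0[of x i] V_subset_SG[of q m] by auto
    then have "\<bar>level_laplacian q (Suc m) u (F q i x) - f (F q i x)\<bar> < \<epsilon>"
      using N[of "Suc m" "F q i x"] m by simp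
    ultimately show "\<bar>level_laplacian q m (\<lambda>x. u (F q i x)) x - f (F q i x) / 5\<bar> < \<epsilon>"
      by argo
  qed
qed

section \<open>Reflections of the gasket\<close>

text \<open>The affine map that moves the vertices by \<open>\<pi>\<close>. In coordinates all three
  reflections are treated at once, and compatibility with midpoints, hence with the contractions up
  to relabelling, is immediate.\<close>

definition symm :: "(3 \<Rightarrow> 3) \<Rightarrow> real^2 \<Rightarrow> real^2" where
  "symm \<pi> x = (\<Sum>i\<in>UNIV. bary i x *\<^sub>R q (\<pi> i))"

lemma symm_vertex [simp]: "symm \<pi> (q i) = q (\<pi> i)"
  using three_cases[of i] by (auto simp: symm_def bary_vertex sum_three)

lemma symm_F: "symm \<pi> (F q i x) = F q (\<pi> i) (symm \<pi> x)"
proof -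
  have "symm \<pi> ((1/2) *\<^sub>R (x + y)) = (1/2) *\<^sub>R (symm \<pi> x + symm \<pi> y)" for x y
    unfolding symm_def bary_midpoint
    by (simp add: sum_three scaleR_add_right scaleR_add_left add_divide_distrib)
  then show ?thesis by (simp add: F_eq)
qed

lemma symm_funpow_F: "symm \<pi> ((F q i ^^ m) x) = (F q (\<pi> i) ^^ m) (symm \<pi> x)"
  by (induction m) (auto simp: symm_F)

lemma continuous_on_symm [continuous_intros]: "continuous_on A (symm \<pi>)"
  unfolding symm_def by (intro continuous_intros)

context
  fixes \<pi> :: "3 \<Rightarrow> 3"
  assumes inv: "\<And>i. \<pi> (\<pi> i) = i"
begin

text \<open>The image of the gasket is covered by its own contracted copies, since
  \<open>symm\<close> only relabels the contractions; \<open>gasket_subset\<close> then places it in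
  the gasket.\<close>

lemma symm_in_SG: "x \<in> SG q \<Longrightarrow> symm \<pi> x \<in> SG q"
proof -
  have "symm \<pi> ` SG q \<subseteq> SG q"
  proof (rule gasket_subset[of _ q])
    show "compact (symm \<pi> ` SG q)"
      by (intro compact_continuous_image continuous_intros SG_compact)
    show "symm \<pi> ` SG q \<subseteq> (\<Union>i. F q i ` symm \<pi> ` SG q)"
      by (subst SG_self_similar) (fastforce simp: symm_F)
  qed (use SG_compact SG_nonempty in auto)
  then show "x \<in> SG q \<Longrightarrow> symm \<pi> x \<in> SG q" by blast
qed

text \<open>The fixed points of the square form a closed set that contains \<open>q 0\<close> and is
  stable under each \<open>F q i\<close>, because relabelling twice changes nothing.\<close>

lemma symm_symm:
  assumes "x \<in> SG q"
  shows "symm \<pi> (symm \<pi> x) = x"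
proof -
  have "compact {x \<in> SG q. symm \<pi> (symm \<pi> x) = x}"
  proof -
    have "closed {x. symm \<pi> (symm \<pi> x) = x}"
      by (intro closed_Collect_eq continuous_intros
          continuous_on_compose2[of UNIV "symm \<pi>" UNIV "symm \<pi>"]) auto
    from compact_Int_closed[OF SG_compact this] show ?thesis by (simp add: Collect_conj_eq)
  qed
  moreover have "q 0 \<in> {x \<in> SG q. symm \<pi> (symm \<pi> x) = x}" using inv by simp
  ultimately have "SG q \<subseteq> {x \<in> SG q. symm \<pi> (symm \<pi> x) = x}"
    by (intro SG_subset_invariant) (auto simp: symm_F inv)
  with assms show ?thesis by blast
qed

lemma symm_in_V: "x \<in> V q m \<Longrightarrow> symm \<pi> x \<in> V q m"
  by (induction m arbitrary: x) (fastforce simp: symm_F)+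

lemma symm_in_cell: "x \<in> cell q w \<Longrightarrow> symm \<pi> x \<in> cell q (map \<pi> w)"
  by (induction w arbitrary: x) (auto simp: symm_F symm_in_SG)

lemma symm_notin_V0:
  assumes "x \<in> SG q" "x \<notin> V q 0"
  shows "symm \<pi> x \<notin> V q 0"
  using symm_in_V[of "symm \<pi> x" 0] symm_symm assms by auto

lemma inj_on_symm: "inj_on (symm \<pi>) (SG q)"
  using symm_symm by (metis inj_onI)

lemma symm_in_neighbours:
  assumes "x \<in> SG q" "y \<in> neighbours q m x"
  shows "symm \<pi> y \<in> neighbours q m (symm \<pi> x)"
proof -
  obtain w where w: "length w = m" "x \<in> cell q w" "y \<in> cell q w" and y: "y \<in> V q m" "y \<noteq> x"
    using assms by (auto simp: neighbours_def)
  have "symm \<pi> y \<noteq> symm \<pi> x"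
    using inj_on_symm assms y V_subset_SG by (auto simp: inj_on_def)
  moreover have "length (map \<pi> w) = m \<and> symm \<pi> x \<in> cell q (map \<pi> w) \<and> symm \<pi> y \<in> cell q (map \<pi> w)"
    using w symm_in_cell by simp
  ultimately show ?thesis unfolding neighbours_def using symm_in_V[OF y(1)] by blast
qed

lemma neighbours_symm:
  assumes "x \<in> SG q"
  shows "neighbours q m (symm \<pi> x) = symm \<pi> ` neighbours q m x"
proof (intro equalityI subsetI)
  fix y assume y: "y \<in> neighbours q m (symm \<pi> x)"
  then have "symm \<pi> y \<in> neighbours q m x"
    using symm_in_neighbours[OF symm_in_SG[OF assms] y] symm_symm[OF assms] by simp
  then show "y \<in> symm \<pi> ` neighbours q m x"
    using symm_symm neighbours_in_SG[OF y] by (metis image_eqI)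
qed (use symm_in_neighbours assms in auto)

lemma has_laplacian_symm:
  assumes "has_laplacian q u f"
  shows "has_laplacian q (\<lambda>x. u (symm \<pi> x)) (\<lambda>x. f (symm \<pi> x))"
  unfolding has_laplacian_def
proof (intro conjI allI impI)
  show "continuous_on (SG q) (\<lambda>x. u (symm \<pi> x))" "continuous_on (SG q) (\<lambda>x. f (symm \<pi> x))"
    using assms symm_in_SG unfolding has_laplacian_def
    by (auto intro!: continuous_on_compose2[of "SG q" _ _ "symm \<pi>"] continuous_intros)
next
  fix \<epsilon> :: real assume "0 < \<epsilon>"
  with assms obtain N where N:
    "\<And>m x. m \<ge> N \<Longrightarrow> x \<in> V q m - V q 0 \<Longrightarrow> \<bar>level_laplacian q m u x - f x\<bar> < \<epsilon>"
    unfolding has_laplacian_def by meson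
  show "\<exists>N. \<forall>m\<ge>N. \<forall>x\<in>V q m - V q 0.
      \<bar>level_laplacian q m (\<lambda>x. u (symm \<pi> x)) x - f (symm \<pi> x)\<bar> < \<epsilon>"
  proof (intro exI[of _ N] allI impI ballI)
    fix m x assume m: "N \<le> m" and x: "x \<in> V q m - V q 0"
    then have xS: "x \<in> SG q" using V_subset_SG by auto
    have "inj_on (symm \<pi>) (neighbours q m x)"
      using inj_on_symm neighbours_in_SG by (metis inj_on_subset subsetI)
    then have "level_laplacian q m u (symm \<pi> x) = level_laplacian q m (\<lambda>x. u (symm \<pi> x)) x"
      unfolding level_laplacian_def neighbours_symm[OF xS] by (simp add: sum.reindex)
    moreover have "symm \<pi> x \<in> V q m - V q 0"
      using x xS symm_in_V symm_notin_V0 by blast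
    ultimately show "\<bar>level_laplacian q m (\<lambda>x. u (symm \<pi> x)) x - f (symm \<pi> x)\<bar> < \<epsilon>"
      using N[OF m] by metis
  qed
qed

end

text \<open>The point is that \<open>V\<^sub>* - V\<^sub>0\<close> is dense.\<close>

lemma has_laplacian_zero_unique:
  assumes "has_laplacian q (\<lambda>x. 0) f" "x \<in> SG q"
  shows "f x = 0"
proof -
  have V: "f x = 0" if x: "x \<in> V q m - V q 0" for x m
  proof (rule ccontr)
    assume "f x \<noteq> 0"
    then have "0 < \<bar>f x\<bar>" by simp
    with assms(1) obtain N where N: "\<And>n y. n \<ge> N \<Longrightarrow> y \<in> V q n - V q 0 \<Longrightarrow>
        \<bar>level_laplacian q n (\<lambda>x. 0) y - f y\<bar> < \<bar>f x\<bar>"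
      unfolding has_laplacian_def by meson
    \<comment> \<open>A point of level \<open>m\<close> has all higher levels too, so the uniform
      bound can be tested at it beyond \<open>N\<close>.\<close>
    have "V q m \<subseteq> V q (max N m)" by (rule lift_Suc_mono_le[where f = "V q"]) (simp_all only: V_mono_Suc max.cobounded2)
    with N[of "max N m" x] x show False by (auto simp: level_laplacian_def)
  qed
  define D where "D = {x \<in> SG q. \<exists>m. x \<in> V q m - V q 0}"
  have "closure D \<subseteq> SG q"
    unfolding D_def by (rule closure_minimal) (use SG_compact compact_imp_closed in auto)
  \<comment> \<open>Density: the closure of \<open>D\<close> is compact and stable under the
    contractions, and it contains the midpoint \<open>F q 0 (q 1)\<close>, which is no vertex
    because its coordinate 0 is 1/2.\<close>
  moreover have "SG q \<subseteq> closure D"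
  proof (rule SG_subset_invariant)
    show "compact (closure D)" using \<open>closure D \<subseteq> SG q\<close> SG_compact
      by (meson bounded_subset closed_closure compact_eq_bounded_closed)
    have "F q 0 (q 1) \<noteq> q j" for j
      using bary_F[of 0 0 "q 1"] bary_vertex[of 0 1] bary_vertex[of 0 j] by (auto split: if_splits)
    then have "F q 0 (q 1) \<in> V q 1 - V q 0" by auto
    then have "F q 0 (q 1) \<in> D" unfolding D_def by blast
    then show "closure D \<noteq> {}" by auto
    have "F q i x \<in> D" if "x \<in> D" for i x
    proof -
      from that obtain m where "x \<in> SG q" "x \<in> V q m - V q 0" unfolding D_def by blast
      then have "F q i x \<in> V q (Suc m) - V q 0" "F q i x \<in> SG q" using F_notin_V0 by auto
      then show ?thesis unfolding D_def by blast
    qed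
    then have "F q i ` closure D \<subseteq> closure D" for i
      by (intro image_closure_subset continuous_intros) (use closure_subset in auto)
    then show "\<And>i x. x \<in> closure D \<Longrightarrow> F q i x \<in> closure D" by blast
  qed
  ultimately have cl: "closure D = SG q" by blast
  have "f x = 0" if "x \<in> closure D" for x
  proof (rule continuous_constant_on_closure[OF _ _ that])
    show "continuous_on (closure D) f" using assms(1) cl by (simp add: has_laplacian_def)
    show "\<And>x. x \<in> D \<Longrightarrow> f x = 0" using V by (auto simp: D_def)
  qed
  with cl assms(2) show ?thesis by blast
qed

end

section \<open>Harmonic functions\<close>

locale gasket_monomials = gasket +
  fixes \<mu> :: "(real^2) measure" and G :: "real^2 \<Rightarrow> real^2 \<Rightarrow> real"
    and P :: "nat \<Rightarrow> real^2 \<Rightarrow> real"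
  assumes measure: "gasket_measure q \<mu>"
    and green: "green_function q \<mu> G"
    and monomial: "antisymmetric_monomial q j (P j)"
begin

lemma green_iff:
  assumes "continuous_on (SG q) f"
  shows "has_laplacian q u (\<lambda>x. - f x) \<and> (\<forall>i. u (q i) = 0) \<longleftrightarrow>
    (\<forall>x\<in>SG q. u x = (LINT y|\<mu>. G x y * f y))"
  using green assms unfolding green_function_def by simp

abbreviation harmonic :: "(real^2 \<Rightarrow> real) \<Rightarrow> bool" where
  "harmonic u \<equiv> has_laplacian q u (\<lambda>x. 0)"

text \<open>For \<open>f = 0\<close> the Green integral vanishes, so uniqueness of the Dirichlet
  problem is contained in the characterisation of \<open>G\<close>; it acts as the maximum principle
  here.\<close>

lemma harmonic_eq_zero:
  assumes "harmonic u" "\<And>i. u (q i) = 0" "x \<in> SG q"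
  shows "u x = 0"
  using green_iff[of "\<lambda>x. 0" u] assms by simp

lemma harmonic_eqI:
  assumes "harmonic u" "harmonic v" "u (q 0) = v (q 0)" "u (q 1) = v (q 1)" "u (q 2) = v (q 2)"
    and "x \<in> SG q"
  shows "u x = v x"
proof -
  have "harmonic (\<lambda>x. u x - v x)" using has_laplacian_diff[OF assms(1,2)] by simp
  moreover have "u (q i) - v (q i) = 0" for i
    using three_cases[of i] assms(3-5) by auto
  ultimately have "u x - v x = 0" using assms(6) by (rule harmonic_eq_zero)
  then show ?thesis by simp
qed

lemma harmonic_F: "harmonic u \<Longrightarrow> harmonic (\<lambda>x. u (F q i x))"
  using has_laplacian_F[of u "\<lambda>x. 0"] by simp

lemma P0: "harmonic (P 0)" "P 0 (q 0) = 0" "has_tangential_derivative_q0 q (P 0) 1"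
proof -
  obtain v where v: "v 0 = P 0" "has_laplacian q (v 0) (v (Suc 0))"
    "\<forall>x\<in>SG q. v (Suc 0) x = 0" "v 0 (q 0) = 0" "has_tangential_derivative_q0 q (v 0) 1"
    using monomial[of 0] unfolding antisymmetric_monomial_def by auto
  then show "harmonic (P 0)" "P 0 (q 0) = 0" "has_tangential_derivative_q0 q (P 0) 1"
    using has_laplacian_cong[OF v(2)] by auto
qed

abbreviation mirror :: "3 \<Rightarrow> 3 \<Rightarrow> real^2 \<Rightarrow> real^2" where
  "mirror i j \<equiv> symm (Transposition.transpose i j)"

lemma transpose_involution: "Transposition.transpose i j (Transposition.transpose i j k) = k"
  by simp

lemmas mirror_in_SG = symm_in_SG[OF transpose_involution]
  and mirror_mirror = symm_symm[OF transpose_involution]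
  and has_laplacian_mirror = has_laplacian_symm[OF transpose_involution]

lemma tangential_mirror:
  assumes "has_tangential_derivative_q0 q u D"
  shows "has_tangential_derivative_q0 q (\<lambda>x. u (mirror 1 2 x)) (- D)"
  using tendsto_minus[OF assms[unfolded has_tangential_derivative_q0_def]]
  unfolding has_tangential_derivative_q0_def symm_funpow_F by (simp add: algebra_simps Transposition.transpose_def)

lemma normal_mirror:
  assumes "has_normal_derivative_q0 q u D"
  shows "has_normal_derivative_q0 q (\<lambda>x. u (mirror 1 2 x)) D"
  using assms
  unfolding has_normal_derivative_q0_def symm_funpow_F by (simp add: algebra_simps Transposition.transpose_def)

lemma tangential_diff:
  assumes "has_tangential_derivative_q0 q u D" "has_tangential_derivative_q0 q v E"
  shows "has_tangential_derivative_q0 q (\<lambda>x. u x - v x) (D - E)"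
  using tendsto_diff[OF assms[unfolded has_tangential_derivative_q0_def]]
  unfolding has_tangential_derivative_q0_def by (simp add: algebra_simps)

lemma normal_diff:
  assumes "has_normal_derivative_q0 q u D" "has_normal_derivative_q0 q v E"
  shows "has_normal_derivative_q0 q (\<lambda>x. u x - v x) (D - E)"
  using tendsto_diff[OF assms[unfolded has_normal_derivative_q0_def]]
  unfolding has_normal_derivative_q0_def by (simp add: algebra_simps)

lemma iterate_eigenfunction:
  fixes u :: "real^2 \<Rightarrow> real"
  assumes "\<And>x. x \<in> SG q \<Longrightarrow> u (F q 0 x) = \<rho> * u x" "x \<in> SG q"
  shows "u ((F q 0 ^^ m) x) = \<rho> ^ m * u x"
proof (induction m)
  case (Suc m)
  then show ?case using assms funpow_F_in_SG[OF assms(2)] by (simp add: mult_ac)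
qed simp

text \<open>The ratio \<open>1/5\<close> need not be computed from the harmonic extension rule: it is the only one
  for which the tangential derivative exists and does not vanish.\<close>

lemma antisymmetric_harmonic:
  obtains A where "harmonic A" "A (q 0) = 0" "A (q 1) = 1" "A (q 2) = - 1"
    "\<And>x. x \<in> SG q \<Longrightarrow> A (mirror 1 2 x) = - A x"
    "\<And>x. x \<in> SG q \<Longrightarrow> A (F q 0 x) = 1/5 * A x"
proof -
  define B where "B x = P 0 x - P 0 (mirror 1 2 x)" for x
  have hB: "harmonic B"
    unfolding B_def using has_laplacian_diff[OF P0(1) has_laplacian_mirror[OF P0(1)]] by simp
  have B0: "B (q 0) = 0" by (simp add: B_def Transposition.transpose_def)
  have anti: "B (mirror 1 2 x) = - B x" if "x \<in> SG q" for x
    using mirror_mirror[OF that] by (simp add: B_def)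
  have tB: "has_tangential_derivative_q0 q B 2"
    unfolding B_def using tangential_diff[OF P0(3) tangential_mirror[OF P0(3)]] by simp
  define a where "a = B (q 1)"
  have B2: "B (q 2) = - a" using anti[of "q 1"] by (simp add: a_def Transposition.transpose_def)
  have "a \<noteq> 0"
  proof
    assume "a = 0"
    then have "B (q i) = 0" for i using three_cases[of i] B0 B2 a_def by auto
    then have "B x = 0" if "x \<in> SG q" for x by (rule harmonic_eq_zero[OF hB _ that])
    then have "has_tangential_derivative_q0 q B 0"
      unfolding has_tangential_derivative_q0_def by (simp add: funpow_F_in_SG)
    with tB show False unfolding has_tangential_derivative_q0_def
      by (auto dest: LIMSEQ_unique)
  qed
  define \<rho> where "\<rho> = B (F q 0 (q 1)) / a"
  \<comment> \<open>\<open>B\<close> composed with \<open>F q 0\<close> is again harmonic,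
    antisymmetric and zero at \<open>q 0\<close>, so its boundary values are proportional to those
    of \<open>B\<close>.\<close>
  have eig: "B (F q 0 x) = \<rho> * B x" if "x \<in> SG q" for x
  proof (rule harmonic_eqI[OF harmonic_F[OF hB] _ _ _ _ that])
    show "harmonic (\<lambda>x. \<rho> * B x)" using has_laplacian_scale[OF hB] by simp
    show "B (F q 0 (q 0)) = \<rho> * B (q 0)" using B0 by simp
    show "B (F q 0 (q 1)) = \<rho> * B (q 1)" using \<open>a \<noteq> 0\<close> by (simp add: \<rho>_def a_def)
    have "F q 0 (q 2) = mirror 1 2 (F q 0 (q 1))" by (simp add: symm_F Transposition.transpose_def)
    then have "B (F q 0 (q 2)) = - B (F q 0 (q 1))" using anti[of "F q 0 (q 1)"] by simp
    then show "B (F q 0 (q 2)) = \<rho> * B (q 2)" using \<open>a \<noteq> 0\<close> by (simp add: \<rho>_def B2)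
  qed
  have lim: "(\<lambda>m. 2 * a * (5 * \<rho>) ^ m) \<longlonglongrightarrow> 2"
  proof -
    have "5 ^ m * (B ((F q 0 ^^ m) (q 1)) - B ((F q 0 ^^ m) (q 2))) = 2 * a * (5 * \<rho>) ^ m" for m
      using iterate_eigenfunction[of B \<rho> _ m, OF eig] B2
      by (simp add: a_def power_mult_distrib)
    then show ?thesis using tB unfolding has_tangential_derivative_q0_def by (simp only:)
  qed
  \<comment> \<open>Shifting the sequence by one multiplies it by \<open>5 * \<rho>\<close> and
    keeps the limit 2.\<close>
  have "(\<lambda>m. 5 * \<rho> * (2 * a * (5 * \<rho>) ^ m)) \<longlonglongrightarrow> 5 * \<rho> * 2"
    by (intro tendsto_mult_left lim)
  moreover have "(\<lambda>m. 5 * \<rho> * (2 * a * (5 * \<rho>) ^ m)) \<longlonglongrightarrow> 2"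
    using LIMSEQ_Suc[OF lim] by (simp add: mult_ac)
  ultimately have "5 * \<rho> * 2 = 2" by (rule LIMSEQ_unique)
  then have \<rho>: "\<rho> = 1/5" by simp
  show ?thesis
  proof (rule that[of "\<lambda>x. 1 / a * B x"])
    show "harmonic (\<lambda>x. 1 / a * B x)" using has_laplacian_scale[OF hB, of "1/a"] by simp
    show "1 / a * B (F q 0 x) = 1/5 * (1 / a * B x)" if "x \<in> SG q" for x
      by (simp only: eig[OF that] \<rho> mult.left_commute)
  qed (use \<open>a \<noteq> 0\<close> B0 B2 anti in \<open>auto simp: a_def\<close>)
qed

text \<open>The symmetric eigenfunction is a combination of the constant and of two copies of the
  antisymmetric one, reflected so that they are antisymmetric at \<open>q 1\<close> and at \<open>q 2\<close>.\<close>

lemma symmetric_harmonic: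
  obtains S where "harmonic S" "S (q 0) = 0" "S (q 1) = 1" "S (q 2) = 1"
    "\<And>x. x \<in> SG q \<Longrightarrow> S (F q 0 x) = 3/5 * S x"
proof -
  obtain A where A: "harmonic A" "A (q 0) = 0" "A (q 1) = 1" "A (q 2) = - 1"
    and anti: "\<And>x. x \<in> SG q \<Longrightarrow> A (mirror 1 2 x) = - A x"
    and eig: "\<And>x. x \<in> SG q \<Longrightarrow> A (F q 0 x) = 1/5 * A x"
    using antisymmetric_harmonic by metis
  \<comment> \<open>On (q_0, q_1, q_2) the two reflected copies have values (-1, 1, 0) and (1, 0,
    -1); their difference plus 2 is (0, 3, 3).\<close>
  define S where "S x = 1/3 * (A (mirror 0 2 x) - A (mirror 0 1 x) + 2)" for x
  have hS: "harmonic S"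
    unfolding S_def
    using has_laplacian_scale[OF has_laplacian_add[OF has_laplacian_diff[OF
          has_laplacian_mirror[OF A(1), of 0 2] has_laplacian_mirror[OF A(1), of 0 1]]
        has_laplacian_const[of q 2]], of "1/3"]
    by simp
  have S: "S (q 0) = 0" "S (q 1) = 1" "S (q 2) = 1"
    using A(2-4) by (simp_all add: S_def Transposition.transpose_def)
  \<comment> \<open>The midpoint of the side opposite \<open>q 0\<close> is fixed by the reflection,
    so \<open>A\<close> vanishes there. With the values 1/5 and -1/5 at the other two midpoints,
    \<open>S\<close> takes the value (2 - 1/5)/3 = 3/5 at both midpoints next to
    \<open>q 0\<close>.\<close>
  have "F q 2 (q 1) = mirror 1 2 (F q 2 (q 1))"
    using F_commute by (simp add: symm_F Transposition.transpose_def)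
  then have A12: "A (F q 2 (q 1)) = 0" "A (F q 1 (q 2)) = 0"
    using anti[of "F q 2 (q 1)"] F_commute[of q 1 2] by auto
  have A0: "A (F q 1 (q 0)) = 1/5" "A (F q 2 (q 0)) = - 1/5"
    using eig[of "q 1"] eig[of "q 2"] A F_commute[of q 0 1] F_commute[of q 0 2] by auto
  show ?thesis
  proof (rule that[OF hS S])
    fix x assume "x \<in> SG q"
    then show "S (F q 0 x) = 3/5 * S x"
    proof (rule harmonic_eqI[OF harmonic_F[OF hS], rotated -1])
      show "harmonic (\<lambda>x. 3/5 * S x)" using has_laplacian_scale[OF hS, of "3/5"] by simp
      show "S (F q 0 (q 0)) = 3/5 * S (q 0)" using S by simp
      show "S (F q 0 (q 1)) = 3/5 * S (q 1)" "S (F q 0 (q 2)) = 3/5 * S (q 2)"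
        unfolding S(2,3) using A12 A0 by (simp_all add: S_def symm_F Transposition.transpose_def)
    qed
  qed
qed

text \<open>As \<open>u\<close> vanishes at \<open>q 0\<close>, it is a combination of the two
  eigenfunctions. The scaled quotients are then the constants \<open>2 * \<alpha>\<close> and
  \<open>- 2 * \<beta>\<close>, so each vanishing derivative removes one coefficient.\<close>

lemma harmonic_zero_jet:
  assumes "harmonic u" "u (q 0) = 0"
    and "has_normal_derivative_q0 q u 0" "has_tangential_derivative_q0 q u 0" "x \<in> SG q"
  shows "u x = 0"
proof -
  obtain A where A: "harmonic A" "A (q 0) = 0" "A (q 1) = 1" "A (q 2) = - 1"
    and eigA: "\<And>x. x \<in> SG q \<Longrightarrow> A (F q 0 x) = 1/5 * A x"
    using antisymmetric_harmonic by metis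
  obtain S where S: "harmonic S" "S (q 0) = 0" "S (q 1) = 1" "S (q 2) = 1"
    and eigS: "\<And>x. x \<in> SG q \<Longrightarrow> S (F q 0 x) = 3/5 * S x"
    using symmetric_harmonic by metis
  define \<alpha> \<beta> where "\<alpha> = (u (q 1) - u (q 2)) / 2" and "\<beta> = (u (q 1) + u (q 2)) / 2"
  have u: "u x = \<alpha> * A x + \<beta> * S x" if "x \<in> SG q" for x
  proof (rule harmonic_eqI[OF assms(1) _ _ _ _ that])
    show "harmonic (\<lambda>x. \<alpha> * A x + \<beta> * S x)"
      using has_laplacian_add[OF has_laplacian_scale[OF A(1)] has_laplacian_scale[OF S(1)]] by simp
  qed (use A S assms(2) in \<open>simp_all add: \<alpha>_def \<beta>_def field_simps\<close>)
  have um: "u ((F q 0 ^^ m) (q i)) = \<alpha> * ((1/5) ^ m * A (q i)) + \<beta> * ((3/5) ^ m * S (q i))" for m i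
    using u[OF funpow_F_in_SG[of "q i"]] iterate_eigenfunction[of A, OF eigA, of "q i" m]
      iterate_eigenfunction[of S, OF eigS, of "q i" m]
    by simp
  have "(\<lambda>m. 2 * \<alpha>) \<longlonglongrightarrow> 0"
  proof -
    have "5 ^ m * (u ((F q 0 ^^ m) (q 1)) - u ((F q 0 ^^ m) (q 2))) = 2 * \<alpha>" for m
      unfolding um A S by (simp add: power_divide field_simps)
    then show ?thesis using assms(4) unfolding has_tangential_derivative_q0_def by (simp only:)
  qed
  then have "\<alpha> = 0" by (simp add: LIMSEQ_const_iff)
  have "(\<lambda>m. - 2 * \<beta>) \<longlonglongrightarrow> 0"
  proof -
    have "(5/3) ^ m * (2 * u (q 0) - u ((F q 0 ^^ m) (q 1)) - u ((F q 0 ^^ m) (q 2))) = - 2 * \<beta>" for m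
      unfolding um A S assms(2) by (simp add: power_divide field_simps)
    then show ?thesis using assms(3) unfolding has_normal_derivative_q0_def by (simp only:)
  qed
  then have "\<beta> = 0" by (simp add: LIMSEQ_const_iff)
  with \<open>\<alpha> = 0\<close> u assms(5) show ?thesis by simp
qed

section \<open>Polyharmonic functions and the monomials\<close>

text \<open>Downward induction from \<open>v (Suc j)\<close>: once \<open>v (Suc m)\<close>
  vanishes, \<open>v m\<close> is harmonic with zero jet. The iterated Laplacians are a given
  sequence because \<open>has_laplacian\<close> is a relation.\<close>

lemma polyharmonic_zero_jet:
  assumes lap: "\<And>m. m \<le> j \<Longrightarrow> has_laplacian q (v m) (v (Suc m))"
    and last: "\<And>x. x \<in> SG q \<Longrightarrow> v (Suc j) x = 0"
    and jet: "\<And>m. m \<le> j \<Longrightarrow> v m (q 0) = 0"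
      "\<And>m. m \<le> j \<Longrightarrow> has_normal_derivative_q0 q (v m) 0"
      "\<And>m. m \<le> j \<Longrightarrow> has_tangential_derivative_q0 q (v m) 0"
    and "x \<in> SG q"
  shows "v 0 x = 0"
proof -
  have "\<forall>x\<in>SG q. v m x = 0" if "m \<le> Suc j" for m
    using that
  proof (induction rule: inc_induct)
    case base
    then show ?case using last by blast
  next
    case (step m)
    then have "m \<le> j" by simp
    have "harmonic (v m)"
      by (rule has_laplacian_cong[OF lap[OF \<open>m \<le> j\<close>]]) (use step.IH in auto)
    then show ?case using jet \<open>m \<le> j\<close> harmonic_zero_jet by blast
  qed
  then show ?thesis using assms(6) by blast
qed

lemma antisymmetric_monomial_unique:
  assumes "antisymmetric_monomial q j u" "antisymmetric_monomial q j v" "x \<in> SG q"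
  shows "u x = v x"
proof -
  obtain a where a: "a 0 = u" "\<And>m. m \<le> j \<Longrightarrow> has_laplacian q (a m) (a (Suc m))"
    "\<And>x. x \<in> SG q \<Longrightarrow> a (Suc j) x = 0" "\<And>m. m \<le> j \<Longrightarrow> a m (q 0) = 0"
    "\<And>m. m \<le> j \<Longrightarrow> has_normal_derivative_q0 q (a m) 0"
    "\<And>m. m \<le> j \<Longrightarrow> has_tangential_derivative_q0 q (a m) (if m = j then 1 else 0)"
    using assms(1) unfolding antisymmetric_monomial_def by blast
  obtain b where b: "b 0 = v" "\<And>m. m \<le> j \<Longrightarrow> has_laplacian q (b m) (b (Suc m))"
    "\<And>x. x \<in> SG q \<Longrightarrow> b (Suc j) x = 0" "\<And>m. m \<le> j \<Longrightarrow> b m (q 0) = 0"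
    "\<And>m. m \<le> j \<Longrightarrow> has_normal_derivative_q0 q (b m) 0"
    "\<And>m. m \<le> j \<Longrightarrow> has_tangential_derivative_q0 q (b m) (if m = j then 1 else 0)"
    using assms(2) unfolding antisymmetric_monomial_def by blast
  have "a 0 x - b 0 x = 0"
  proof (rule polyharmonic_zero_jet[where v = "\<lambda>m x. a m x - b m x" and j = j])
    fix m assume m: "m \<le> j"
    show "has_laplacian q (\<lambda>x. a m x - b m x) (\<lambda>x. a (Suc m) x - b (Suc m) x)"
      using a b m by (intro has_laplacian_diff) auto
    show "has_normal_derivative_q0 q (\<lambda>x. a m x - b m x) 0"
      using normal_diff[OF a(5)[OF m] b(5)[OF m]] by simp
    show "has_tangential_derivative_q0 q (\<lambda>x. a m x - b m x) 0"
      using tangential_diff[OF a(6)[OF m] b(6)[OF m]] by simp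
  qed (use a b assms(3) in auto)
  then show ?thesis using a(1) b(1) by simp
qed

text \<open>Dropping the first member of the chain of iterated Laplacians of
  \<open>P (Suc j)\<close> leaves a chain for a monomial of index \<open>j\<close>, which by
  uniqueness is \<open>P j\<close>.\<close>

lemma has_laplacian_P_Suc: "has_laplacian q (P (Suc j)) (P j)"
proof -
  obtain v where v: "v 0 = P (Suc j)" "\<And>m. m \<le> Suc j \<Longrightarrow> has_laplacian q (v m) (v (Suc m))"
    "\<And>x. x \<in> SG q \<Longrightarrow> v (Suc (Suc j)) x = 0" "\<And>m. m \<le> Suc j \<Longrightarrow> v m (q 0) = 0"
    "\<And>m. m \<le> Suc j \<Longrightarrow> has_normal_derivative_q0 q (v m) 0"
    "\<And>m. m \<le> Suc j \<Longrightarrow> has_tangential_derivative_q0 q (v m) (if m = Suc j then 1 else 0)"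
    using monomial[of "Suc j"] unfolding antisymmetric_monomial_def by blast
  have "antisymmetric_monomial q j (v (Suc 0))"
    unfolding antisymmetric_monomial_def
    using v(2,3,4,5) v(6)[of "Suc _"] by (intro exI[of _ "\<lambda>m. v (Suc m)"]) simp
  then have "P j x = v (Suc 0) x" if "x \<in> SG q" for x
    using antisymmetric_monomial_unique[OF monomial _ that] by blast
  then show ?thesis
    using has_laplacian_cong[OF v(2)[of 0]] v(1) by auto
qed

lemma P_q0: "P j (q 0) = 0"
  using monomial[of j] unfolding antisymmetric_monomial_def by (metis le0)

text \<open>Reflection reverses the tangential derivative and the minus sign restores it, so the
  negated reflection of \<open>P j\<close> is a monomial of the same index.\<close>

lemma P_q2: "P j (q 2) = - P j (q 1)"
proof -
  obtain v where v: "v 0 = P j" "\<And>m. m \<le> j \<Longrightarrow> has_laplacian q (v m) (v (Suc m))"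
    "\<And>x. x \<in> SG q \<Longrightarrow> v (Suc j) x = 0" "\<And>m. m \<le> j \<Longrightarrow> v m (q 0) = 0"
    "\<And>m. m \<le> j \<Longrightarrow> has_normal_derivative_q0 q (v m) 0"
    "\<And>m. m \<le> j \<Longrightarrow> has_tangential_derivative_q0 q (v m) (if m = j then 1 else 0)"
    using monomial[of j] unfolding antisymmetric_monomial_def by blast
  define w where "w m x = 0 - v m (mirror 1 2 x)" for m x
  have T: "has_tangential_derivative_q0 q (\<lambda>x. 0) 0"
    and N: "has_normal_derivative_q0 q (\<lambda>x. 0) 0"
    by (simp_all add: has_tangential_derivative_q0_def has_normal_derivative_q0_def)
  have "antisymmetric_monomial q j (w 0)"
    unfolding antisymmetric_monomial_def
  proof (intro exI[of _ w] conjI allI impI ballI refl)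
    fix m assume m: "m \<le> j"
    show "has_laplacian q (w m) (w (Suc m))"
      unfolding w_def
      using has_laplacian_diff[OF has_laplacian_const[of q 0] has_laplacian_mirror[OF v(2)[OF m]]] by simp
    show "w m (q 0) = 0" using v(4)[OF m] by (simp add: w_def Transposition.transpose_def)
    show "has_normal_derivative_q0 q (w m) 0"
      unfolding w_def using normal_diff[OF N normal_mirror[OF v(5)[OF m]]] by simp
    show "has_tangential_derivative_q0 q (w m) (if m = j then 1 else 0)"
      unfolding w_def using tangential_diff[OF T tangential_mirror[OF v(6)[OF m]]] by simp
  qed (simp add: w_def v(3) mirror_in_SG)
  then have "P j (q 1) = w 0 (q 1)"
    using antisymmetric_monomial_unique[OF monomial] by blast
  then show ?thesis by (simp add: w_def v(1) Transposition.transpose_def)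
qed

lemma tangential_eq_zero:
  assumes "has_tangential_derivative_q0 q u D" "\<And>x. x \<in> SG q \<Longrightarrow> u x = 0"
  shows "D = 0"
  using assms LIMSEQ_unique[OF _ tendsto_const[of "0::real"]]
  unfolding has_tangential_derivative_q0_def by (simp add: funpow_F_in_SG)

text \<open>Makes the denominator \<gamma>_0 of \<zeta>_k legitimate: otherwise \<open>P 0\<close>
  would vanish on the whole boundary, hence everywhere, against its tangential derivative 1.\<close>

lemma P0_q1: "P 0 (q 1) \<noteq> 0"
proof
  assume "P 0 (q 1) = 0"
  then have "P 0 (q i) = 0" for i using three_cases[of i] P_q0[of 0] P_q2[of 0] by auto
  then have "P 0 x = 0" if "x \<in> SG q" for x by (rule harmonic_eq_zero[OF P0(1) _ that])
  then have "(1::real) = 0" by (rule tangential_eq_zero[OF P0(3)])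
  then show False by simp
qed

text \<open>The Laplacian removes \<open>P 0\<close> from a relation and lowers the other indices by
  one, which drives the induction; the Laplacian of zero is zero by
  \<open>has_laplacian_zero_unique\<close>. What remains is a multiple of
  \<open>P 0\<close>.\<close>

lemma P_independent:
  assumes "\<And>x. x \<in> SG q \<Longrightarrow> (\<Sum>l\<le>k. a l * P l x) = 0" "l \<le> k"
  shows "a l = 0"
  using assms
proof (induction k arbitrary: a l)
  case 0
  have "has_tangential_derivative_q0 q (\<lambda>x. a 0 * P 0 x) (a 0 * 1)"
    using tendsto_mult_left[OF P0(3)[unfolded has_tangential_derivative_q0_def], of "a 0"]
    unfolding has_tangential_derivative_q0_def by (simp add: algebra_simps)
  then have "a 0 = 0" using tangential_eq_zero[OF _ "0.prems"(1)] by simp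
  with 0 show ?case by simp
next
  case (Suc k)
  have "has_laplacian q (\<lambda>x. a 0 * P 0 x + (\<Sum>l\<in>{..k}. a (Suc l) * P (Suc l) x))
      (\<lambda>x. a 0 * 0 + (\<Sum>l\<in>{..k}. a (Suc l) * P l x))"
    by (intro has_laplacian_add has_laplacian_scale has_laplacian_sum P0 has_laplacian_P_Suc)
  then have "has_laplacian q (\<lambda>x. 0) (\<lambda>x. a 0 * 0 + (\<Sum>l\<in>{..k}. a (Suc l) * P l x))"
    by (rule has_laplacian_cong) (use Suc.prems(1) in \<open>simp_all only: sum.atMost_Suc_shift\<close>)
  then have "(\<Sum>l\<le>k. a (Suc l) * P l x) = 0" if "x \<in> SG q" for x
    using has_laplacian_zero_unique[OF _ that] by fastforce
  then have aS: "a (Suc l) = 0" if "l \<le> k" for l using Suc.IH[of "\<lambda>l. a (Suc l)"] that by blast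
  then have "(\<Sum>l\<le>Suc k. a l * P l x) = a 0 * P 0 x" for x
    unfolding sum.atMost_Suc_shift by simp
  then have "a 0 * P 0 (q 1) = 0" using Suc.prems(1)[of "q 1"] by simp
  then have "a 0 = 0" using P0_q1 by simp
  with aS show ?case using \<open>l \<le> Suc k\<close> by (cases l) auto
qed

section \<open>The inner product and the Green operator\<close>

lemma prob_space: "prob_space \<mu>" and sets_\<mu>: "sets \<mu> = sets (restrict_space borel (SG q))"
  using measure by (simp_all add: gasket_measure_def)

lemma space_\<mu>: "space \<mu> = SG q"
  using sets_eq_imp_space_eq[OF sets_\<mu>] by (simp add: space_restrict_space)

lemma borel_measurable_continuous:
  fixes u :: "real^2 \<Rightarrow> real"
  shows "continuous_on (SG q) u \<Longrightarrow> u \<in> borel_measurable \<mu>"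
  using borel_measurable_continuous_on_restrict measurable_cong_sets[OF sets_\<mu> refl] by blast

lemma integrable_continuous:
  fixes u :: "real^2 \<Rightarrow> real"
  assumes "continuous_on (SG q) u"
  shows "integrable \<mu> u"
proof -
  interpret prob_space \<mu> by (rule prob_space)
  obtain B where "\<forall>x\<in>SG q. norm (u x) \<le> B"
    using compact_imp_bounded[OF compact_continuous_image[OF assms SG_compact]]
    unfolding bounded_iff by auto
  then show ?thesis
    by (intro integrable_const_bound[of _ B] borel_measurable_continuous assms)
      (auto simp: space_\<mu> intro!: AE_I2)
qed

abbreviation ip :: "(real^2 \<Rightarrow> real) \<Rightarrow> (real^2 \<Rightarrow> real) \<Rightarrow> real" where
  "ip \<equiv> L2_inner \<mu>"

lemma ip_commute: "ip u v = ip v u"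
  by (simp add: L2_inner_def mult.commute)

lemma ip_cong:
  "(\<And>x. x \<in> SG q \<Longrightarrow> u x = u' x) \<Longrightarrow> (\<And>x. x \<in> SG q \<Longrightarrow> v x = v' x) \<Longrightarrow> ip u v = ip u' v'"
  unfolding L2_inner_def by (intro Bochner_Integration.integral_cong) (auto simp: space_\<mu>)

lemma ip_nonneg: "ip u u \<ge> 0"
  unfolding L2_inner_def by (intro integral_nonneg_AE) auto

lemma ip_add_left:
  assumes "continuous_on (SG q) u" "continuous_on (SG q) v" "continuous_on (SG q) w"
  shows "ip (\<lambda>x. u x + v x) w = ip u w + ip v w"
  unfolding L2_inner_def distrib_right
  by (intro Bochner_Integration.integral_add integrable_continuous continuous_intros assms)

lemma ip_diff_left:
  assumes "continuous_on (SG q) u" "continuous_on (SG q) v" "continuous_on (SG q) w"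
  shows "ip (\<lambda>x. u x - v x) w = ip u w - ip v w"
  unfolding L2_inner_def left_diff_distrib
  by (intro Bochner_Integration.integral_diff integrable_continuous continuous_intros assms)

lemma ip_sum_left:
  assumes "\<And>i. i \<in> I \<Longrightarrow> continuous_on (SG q) (u i)" "continuous_on (SG q) w"
  shows "ip (\<lambda>x. \<Sum>i\<in>I. a i * u i x) w = (\<Sum>i\<in>I. a i * ip (u i) w)"
proof -
  have "(LINT x|\<mu>. (\<Sum>i\<in>I. a i * (u i x * w x))) = (\<Sum>i\<in>I. LINT x|\<mu>. a i * (u i x * w x))"
    by (intro Bochner_Integration.integral_sum integrable_continuous continuous_intros assms)
  then show ?thesis
    unfolding L2_inner_def sum_distrib_right by (simp add: mult.assoc)
qed

text \<open>The sign makes this the solution operator of Laplacian = \<open>u\<close> with zero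
  boundary values; \<open>potential (p k)\<close> is f_{k+1}.\<close>

definition potential :: "(real^2 \<Rightarrow> real) \<Rightarrow> real^2 \<Rightarrow> real" where
  "potential u x = - (LINT y|\<mu>. G x y * u y)"

lemma potential_iff:
  assumes "continuous_on (SG q) f"
  shows "has_laplacian q u f \<and> (\<forall>i. u (q i) = 0) \<longleftrightarrow> (\<forall>x\<in>SG q. u x = potential f x)"
proof -
  have "has_laplacian q u f \<longleftrightarrow> has_laplacian q (\<lambda>x. - u x) (\<lambda>x. - f x)"
    using has_laplacian_scale[of q u f "-1"] has_laplacian_scale[of q "\<lambda>x. - u x" "\<lambda>x. - f x" "-1"]
    by auto
  then show ?thesis
    using green_iff[OF assms, of "\<lambda>x. - u x"]
    by (simp add: potential_def minus_equation_iff[of "u _"]) (metis add.inverse_inverse)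
qed

text \<open>Fubini and the symmetry of \<open>G\<close>; the work lies in the joint measurability of
  the integrand.\<close>

lemma potential_symmetric:
  assumes "continuous_on (SG q) u" "continuous_on (SG q) v"
  shows "ip (potential u) v = ip u (potential v)"
proof -
  interpret prob_space \<mu> by (rule prob_space)
  interpret pair_prob_space \<mu> \<mu> ..
  have G: "continuous_on (SG q \<times> SG q) (\<lambda>(x, y). G x y)"
    and sym: "\<And>x y. x \<in> SG q \<Longrightarrow> y \<in> SG q \<Longrightarrow> G x y = G y x"
    using green unfolding green_function_def by blast+
  define g where "g z = G (fst z) (snd z) * u (snd z) * v (fst z)" for z
  have g: "continuous_on (SG q \<times> SG q) g"
    unfolding g_def using G assms
    by (intro continuous_intros continuous_on_compose2[of "SG q" u _ snd]
        continuous_on_compose2[of "SG q" v _ fst]) (auto simp: case_prod_beta)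
  have space: "space (\<mu> \<Otimes>\<^sub>M \<mu>) = SG q \<times> SG q"
    by (simp add: space_pair_measure space_\<mu>)
  \<comment> \<open>Transfers Borel measurability on the full product of planes to the product of
    the two restricted measures.\<close>
  have id: "(\<lambda>z. z) \<in> measurable (\<mu> \<Otimes>\<^sub>M \<mu>) (borel :: ((real^2) \<times> (real^2)) measure)"
  proof -
    have "(\<lambda>x. x) \<in> measurable \<mu> borel"
      unfolding measurable_cong_sets[OF sets_\<mu> refl]
      by (intro measurable_restrict_space1 measurable_ident_sets refl)
    then have "(\<lambda>z. (fst z, snd z)) \<in> measurable (\<mu> \<Otimes>\<^sub>M \<mu>) (borel \<Otimes>\<^sub>M borel)"
      by measurable
    then show ?thesis by (simp add: borel_prod)
  qed
  have "compact (SG q \<times> SG q)" using SG_compact by (intro compact_Times)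
  \<comment> \<open>Continuity of \<open>g\<close> is known only on the compact product, so
    \<open>g\<close> is cut off to zero outside it.\<close>
  then have "(\<lambda>z. indicator (SG q \<times> SG q) z *\<^sub>R g z) \<in> borel_measurable borel"
    using g by (intro borel_measurable_continuous_on_indicator borel_closed compact_imp_closed)
  then have "(\<lambda>z. indicator (SG q \<times> SG q) z *\<^sub>R g z) \<in> borel_measurable (\<mu> \<Otimes>\<^sub>M \<mu>)"
    using measurable_compose[OF id] by fast
  then have meas: "g \<in> borel_measurable (\<mu> \<Otimes>\<^sub>M \<mu>)"
    by (rule measurable_cong[THEN iffD1, rotated]) (simp add: space)
  obtain B where B: "\<forall>z\<in>SG q \<times> SG q. norm (g z) \<le> B"
    using compact_imp_bounded[OF compact_continuous_image[OF g \<open>compact (SG q \<times> SG q)\<close>]]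
    unfolding bounded_iff by auto
  have "integrable (\<mu> \<Otimes>\<^sub>M \<mu>) g"
    by (rule integrable_const_bound[of _ B]) (use B meas in \<open>auto simp: space intro!: AE_I2\<close>)
  then have int: "integrable (\<mu> \<Otimes>\<^sub>M \<mu>) (\<lambda>(x, y). g (x, y))"
    by (simp add: case_prod_beta)
  have "ip (potential u) v = (LINT x|\<mu>. - (LINT y|\<mu>. g (x, y)))"
    unfolding L2_inner_def potential_def g_def by simp
  also have "\<dots> = - (LINT x|\<mu>. LINT y|\<mu>. g (x, y))" by simp
  also have "\<dots> = - (LINT y|\<mu>. LINT x|\<mu>. g (x, y))"
    using Fubini_integral[OF int] by simp
  also have "\<dots> = (LINT y|\<mu>. - (LINT x|\<mu>. g (x, y)))" by simp
  also have "\<dots> = ip u (potential v)"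
    unfolding L2_inner_def
  proof (rule Bochner_Integration.integral_cong[OF refl])
    fix y assume "y \<in> space \<mu>"
    then have "y \<in> SG q" by (simp add: space_\<mu>)
    then have "(LINT x|\<mu>. g (x, y)) = (LINT x|\<mu>. u y * (G y x * v x))"
      by (intro Bochner_Integration.integral_cong) (auto simp: g_def sym space_\<mu>)
    then show "- (LINT x|\<mu>. g (x, y)) = u y * potential v y"
      by (simp add: potential_def)
  qed
  finally show ?thesis .
qed

lemma continuous_on_P [continuous_intros]: "continuous_on (SG q) (P l)"
  using P0(1) has_laplacian_P_Suc has_laplacian_continuous(1) by (cases l) blast+

text \<open>A function that is zero almost everywhere has potential zero at every point. Hence the
  zero function has Laplacian \<open>u\<close>, and the Laplacian of zero is zero
  everywhere.\<close>

lemma ip_self_eq_zero: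
  assumes "continuous_on (SG q) u" "ip u u = 0" "x \<in> SG q"
  shows "u x = 0"
proof -
  have "AE y in \<mu>. u y * u y = 0"
    using integral_nonneg_eq_0_iff_AE[of \<mu> "\<lambda>y. u y * u y"] assms(1,2)
    by (simp add: L2_inner_def integrable_continuous continuous_on_mult)
  then have AE: "AE y in \<mu>. u y = 0" by simp
  have "potential u y = 0" for y
  proof -
    have "AE z in \<mu>. G y z * u z = 0" using AE by eventually_elim simp
    then show ?thesis by (simp add: potential_def integral_eq_zero_AE)
  qed
  then have "has_laplacian q (\<lambda>x. 0) u"
    using potential_iff[OF assms(1), of "\<lambda>x. 0"] by simp
  then show ?thesis using assms(3) by (rule has_laplacian_zero_unique)
qed

end

section \<open>Orthogonal polynomials and the three-term recurrence\<close>

locale gasket_orthogonal = gasket_monomials +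
  fixes \<omega> :: "nat \<Rightarrow> nat \<Rightarrow> real"
  assumes gram_schmidt_expansion:
      "x \<in> SG q \<Longrightarrow> gram_schmidt \<mu> P k x = (\<Sum>l\<le>k. \<omega> k l * P l x)"
    and monic: "\<omega> k k = 1"
begin

abbreviation p :: "nat \<Rightarrow> real^2 \<Rightarrow> real" where
  "p \<equiv> gram_schmidt \<mu> P"

lemma continuous_on_p [continuous_intros]: "continuous_on (SG q) (p k)"
proof -
  have "continuous_on (SG q) (\<lambda>x. \<Sum>l\<le>k. \<omega> k l * P l x)" by (intro continuous_intros)
  then show ?thesis by (simp cong: continuous_on_cong add: gram_schmidt_expansion)
qed

text \<open>A polynomial of norm zero would vanish on the gasket, and independence would make its
  leading coefficient zero instead of 1.\<close>

lemma ip_p_pos: "ip (p k) (p k) > 0"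
proof -
  have "ip (p k) (p k) \<noteq> 0"
  proof
    assume "ip (p k) (p k) = 0"
    then have "(\<Sum>l\<le>k. \<omega> k l * P l x) = 0" if "x \<in> SG q" for x
      using ip_self_eq_zero[OF continuous_on_p _ that] gram_schmidt_expansion[OF that] by metis
    then have "\<omega> k k = 0" using P_independent[where k = k and a = "\<omega> k" and l = k] by blast
    then show False by (simp add: monic)
  qed
  then show ?thesis using ip_nonneg[of "p k"] by linarith
qed

lemma inverse_norm_square: "(1 / L2_norm \<mu> u)\<^sup>2 = 1 / ip u u"
  using ip_nonneg[of u] by (simp add: L2_norm_def power_divide)

lemma gram_schmidt_step:
  "p j x = P j x - (\<Sum>l<j. ip (P j) (p l) / ip (p l) (p l) * p l x)"
  by (subst gram_schmidt.simps) (simp add: inverse_norm_square)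

lemma orthogonal_less: "i < j \<Longrightarrow> ip (p j) (p i) = 0"
proof (induction j arbitrary: i rule: less_induct)
  case (less j)
  \<comment> \<open>Both indices lie below \<open>j\<close>, so the induction hypothesis applies to
    the larger of them.\<close>
  have orth: "ip (p l) (p i) = 0" if "l < j" "l \<noteq> i" for l
    using less.IH[of l i] less.IH[of i l] less.prems that ip_commute[of "p l"]
    by (cases "i < l") auto
  have "ip (p j) (p i) =
      ip (\<lambda>x. P j x - (\<Sum>l<j. ip (P j) (p l) / ip (p l) (p l) * p l x)) (p i)"
    by (rule ip_cong[OF gram_schmidt_step refl])
  also have "\<dots> = ip (P j) (p i) - (\<Sum>l<j. ip (P j) (p l) / ip (p l) (p l) * ip (p l) (p i))"
  proof -
    have "ip (\<lambda>x. \<Sum>l<j. ip (P j) (p l) / ip (p l) (p l) * p l x) (p i)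
        = (\<Sum>l<j. ip (P j) (p l) / ip (p l) (p l) * ip (p l) (p i))"
      by (rule ip_sum_left; intro continuous_intros)
    moreover have "ip (\<lambda>x. P j x - (\<Sum>l<j. ip (P j) (p l) / ip (p l) (p l) * p l x)) (p i)
        = ip (P j) (p i) - ip (\<lambda>x. \<Sum>l<j. ip (P j) (p l) / ip (p l) (p l) * p l x) (p i)"
      by (rule ip_diff_left; intro continuous_intros)
    ultimately show ?thesis by simp
  qed
  also have "(\<Sum>l<j. ip (P j) (p l) / ip (p l) (p l) * ip (p l) (p i))
      = (\<Sum>l<j. if l = i then ip (P j) (p i) else 0)"
    using orth ip_p_pos by (intro sum.cong) (auto simp: less_imp_neq[symmetric])
  finally show ?case using less.prems by simp
qed

lemma orthogonal: "i \<noteq> j \<Longrightarrow> ip (p i) (p j) = 0"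
  using orthogonal_less ip_commute by (metis linorder_neqE_nat)

text \<open>Gram-Schmidt is triangular with unit diagonal, so it can be inverted degree by
  degree.\<close>

lemma span_p:
  "\<exists>a. \<forall>x. (\<Sum>l\<le>k. e l * P l x) = (\<Sum>i\<le>k. a i * p i x)"
proof (induction k)
  case 0
  show ?case using gram_schmidt_step[of 0] by auto
next
  case (Suc k)
  then obtain a where a: "\<And>x. (\<Sum>l\<le>k. e l * P l x) = (\<Sum>i\<le>k. a i * p i x)" by blast
  define r where "r i = ip (P (Suc k)) (p i) / ip (p i) (p i)" for i
  have "P (Suc k) x = p (Suc k) x + (\<Sum>i\<le>k. r i * p i x)" for x
    using gram_schmidt_step[of "Suc k" x] by (simp add: r_def lessThan_Suc_atMost)
  then have "(\<Sum>l\<le>Suc k. e l * P l x)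
      = (\<Sum>i\<le>k. (a i + e (Suc k) * r i) * p i x) + e (Suc k) * p (Suc k) x" for x
    by (simp add: a sum_distrib_left distrib_left distrib_right sum.distrib mult.assoc)
  moreover have "(\<Sum>i\<le>Suc k. (if i = Suc k then e (Suc k) else a i + e (Suc k) * r i) * p i x)
      = (\<Sum>i\<le>k. (a i + e (Suc k) * r i) * p i x) + e (Suc k) * p (Suc k) x" for x
    by simp
  ultimately show ?case
    by (intro exI[of _ "\<lambda>i. if i = Suc k then e (Suc k) else a i + e (Suc k) * r i"])
      (simp only: simp_thms)
qed

text \<open>The multiple of \<open>P 0\<close> that cancels the value at \<open>q 1\<close> of the
  lifted sum of the \<open>P (l + 1)\<close>.\<close>

definition zeta :: "nat \<Rightarrow> real" where
  "zeta k = - (1 / P 0 (q 1)) * (\<Sum>l\<le>k. \<omega> k l * P (l + 1) (q 1))"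

text \<open>The right-hand side has Laplacian \<open>p k\<close> and vanishes at \<open>q 0\<close>
  term by term, at \<open>q 1\<close> by the choice of \<open>zeta\<close>, and at
  \<open>q 2\<close> by antisymmetry; \<open>potential_iff\<close> identifies it.\<close>

lemma potential_p:
  assumes "x \<in> SG q"
  shows "potential (p k) x = zeta k * P 0 x + (\<Sum>l\<le>k. \<omega> k l * P (Suc l) x)"
proof -
  define u where "u x = zeta k * P 0 x + (\<Sum>l\<le>k. \<omega> k l * P (Suc l) x)" for x
  have "has_laplacian q u (\<lambda>x. zeta k * 0 + (\<Sum>l\<le>k. \<omega> k l * P l x))"
    unfolding u_def
    by (intro has_laplacian_add has_laplacian_scale has_laplacian_sum P0 has_laplacian_P_Suc)
  then have "has_laplacian q u (p k)"
    by (rule has_laplacian_cong) (auto simp: gram_schmidt_expansion)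
  moreover have "u (q i) = 0" for i
  proof -
    have "u (q 0) = 0" by (simp add: u_def P_q0)
    moreover have "u (q 1) = 0" using P0_q1 by (simp add: u_def zeta_def)
    moreover have "u (q 2) = - u (q 1)" by (simp add: u_def P_q2 sum_negf)
    ultimately show ?thesis using three_cases[of i] by auto
  qed
  ultimately have "u x = potential (p k) x"
    using potential_iff[OF continuous_on_p] assms by blast
  then show ?thesis by (simp add: u_def)
qed

text \<open>The case expression is the vector with entry \<zeta>_k on top of \<Omega>_k: raising
  every index by one frees position 0.\<close>

lemma zeta_sum:
  "zeta k * P 0 x + (\<Sum>l\<le>k. \<omega> k l * P (Suc l) x)
    = (\<Sum>l\<le>Suc k. (case l of 0 \<Rightarrow> zeta k | Suc i \<Rightarrow> \<omega> k i) * P l x)"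
  by (simp add: sum.atMost_Suc_shift del: sum.atMost_Suc)

lemma potential_p_expansion:
  "\<exists>a. \<forall>x\<in>SG q. potential (p k) x = p (Suc k) x + (\<Sum>i\<le>k. a i * p i x)"
proof -
  define e where "e l = (case l of 0 \<Rightarrow> zeta k | Suc i \<Rightarrow> \<omega> k i) - \<omega> (Suc k) l" for l
  have "potential (p k) x - p (Suc k) x = (\<Sum>l\<le>k. e l * P l x)" if "x \<in> SG q" for x
  proof -
    have "potential (p k) x - p (Suc k) x = (\<Sum>l\<le>Suc k. e l * P l x)"
      unfolding potential_p[OF that] zeta_sum gram_schmidt_expansion[OF that] e_def
      by (simp add: left_diff_distrib sum_subtractf del: sum.atMost_Suc)
    \<comment> \<open>Both polynomials have leading coefficient 1, so the term of degree
      \<open>Suc k\<close> cancels.\<close>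
    then show ?thesis by (simp add: e_def monic)
  qed
  moreover obtain a where "\<And>x. (\<Sum>l\<le>k. e l * P l x) = (\<Sum>i\<le>k. a i * p i x)"
    using span_p[of e k] by blast
  ultimately have "potential (p k) x = p (Suc k) x + (\<Sum>i\<le>k. a i * p i x)" if "x \<in> SG q" for x
    using that by (simp add: diff_eq_eq add.commute)
  then show ?thesis by blast
qed

lemma ip_potential_expansion:
  assumes "\<And>x. x \<in> SG q \<Longrightarrow> potential (p k) x = p (Suc k) x + (\<Sum>i\<le>k. a i * p i x)"
  shows "ip (potential (p k)) (p j) =
    (if j = Suc k then ip (p j) (p j) else if j \<le> k then a j * ip (p j) (p j) else 0)"
proof -
  have "ip (potential (p k)) (p j) = ip (\<lambda>x. p (Suc k) x + (\<Sum>i\<le>k. a i * p i x)) (p j)"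
    using assms by (intro ip_cong) auto
  also have "\<dots> = ip (p (Suc k)) (p j) + (\<Sum>i\<le>k. a i * ip (p i) (p j))"
  proof -
    have "ip (\<lambda>x. \<Sum>i\<le>k. a i * p i x) (p j) = (\<Sum>i\<le>k. a i * ip (p i) (p j))"
      by (rule ip_sum_left; intro continuous_intros)
    moreover have "ip (\<lambda>x. p (Suc k) x + (\<Sum>i\<le>k. a i * p i x)) (p j)
        = ip (p (Suc k)) (p j) + ip (\<lambda>x. \<Sum>i\<le>k. a i * p i x) (p j)"
      by (rule ip_add_left; intro continuous_intros)
    ultimately show ?thesis by simp
  qed
  also have "(\<Sum>i\<le>k. a i * ip (p i) (p j)) = (\<Sum>i\<le>k. if i = j then a j * ip (p j) (p j) else 0)"
    by (intro sum.cong) (auto simp: orthogonal)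
  finally show ?thesis using orthogonal[of "Suc k" j] by auto
qed

lemma ip_potential_p:
  "j > Suc k \<Longrightarrow> ip (potential (p k)) (p j) = 0"
  "ip (potential (p k)) (p (Suc k)) = ip (p (Suc k)) (p (Suc k))"
proof -
  obtain a where a: "\<And>x. x \<in> SG q \<Longrightarrow> potential (p k) x = p (Suc k) x + (\<Sum>i\<le>k. a i * p i x)"
    using potential_p_expansion[of k] by blast
  show "ip (potential (p k)) (p j) = 0" if "j > Suc k"
    using ip_potential_expansion[OF a, of j] that by simp
  show "ip (potential (p k)) (p (Suc k)) = ip (p (Suc k)) (p (Suc k))"
    using ip_potential_expansion[OF a, of "Suc k"] by simp
qed

lemma ip_potential_swap: "ip (potential (p k)) (p j) = ip (potential (p j)) (p k)"
  using potential_symmetric[OF continuous_on_p continuous_on_p] ip_commute by metis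

lemma three_term_recurrence:
  assumes "x \<in> SG q"
  shows "potential (p k) x = p (Suc k) x
    + ip (potential (p k)) (p k) / ip (p k) (p k) * p k x
    + (if k = 0 then 0 else ip (p k) (p k) / ip (p (k - 1)) (p (k - 1)) * p (k - 1) x)"
proof -
  obtain a where a: "\<And>x. x \<in> SG q \<Longrightarrow> potential (p k) x = p (Suc k) x + (\<Sum>i\<le>k. a i * p i x)"
    using potential_p_expansion[of k] by blast
  have a_eq: "a j = ip (potential (p j)) (p k) / ip (p j) (p j)" if "j \<le> k" for j
    using ip_potential_expansion[OF a, of j] ip_potential_swap[of k j] ip_p_pos[of j] that
    by (simp add: field_simps)
  have "(\<Sum>i\<le>k. a i * p i x) = a k * p k x + (if k = 0 then 0 else a (k - 1) * p (k - 1) x)"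
  proof (cases k)
    case (Suc n)
    have "a i = 0" if "i < n" for i
      using a_eq[of i] ip_potential_p(1)[of i k] that Suc by simp
    then have "(\<Sum>i<n. a i * p i x) = 0" by simp
    then show ?thesis by (simp add: Suc flip: lessThan_Suc_atMost)
  qed simp
  \<comment> \<open>By symmetry this coefficient is governed by the product of
    \<open>potential (p (k - 1))\<close> with \<open>p k\<close>, which is the squared norm of
    \<open>p k\<close> because the leading coefficient is 1. This is the origin of c_k.\<close>
  moreover have "a (k - 1) = ip (p k) (p k) / ip (p (k - 1)) (p (k - 1))" if "k \<noteq> 0"
    using a_eq[of "k - 1"] ip_potential_p(2)[of "k - 1"] that by simp
  ultimately show ?thesis using a[OF assms] a_eq[of k] by simp
qed

section \<open>Coefficient vectors\<close>

text \<open>Padding with zero coefficients corresponds to the zero blocks appended to \<Omega>_k and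
  \<Omega>_{k-1}.\<close>

lemma sum_P_extend:
  "n \<le> m \<Longrightarrow> (\<Sum>l\<le>n. w l * P l x) = (\<Sum>l\<le>m. (if l \<le> n then w l else 0) * P l x)"
  by (rule sum.mono_neutral_cong_left) auto

lemma coefficient_recurrence:
  assumes "l \<le> Suc k"
  shows "\<omega> (Suc k) l = (case l of 0 \<Rightarrow> zeta k | Suc i \<Rightarrow> \<omega> k i)
    - ip (potential (p k)) (p k) / ip (p k) (p k) * (if l \<le> k then \<omega> k l else 0)
    - (if k = 0 then 0 else ip (p k) (p k) / ip (p (k - 1)) (p (k - 1))
        * (if l \<le> k - 1 then \<omega> (k - 1) l else 0))"
proof -
  \<comment> \<open>At \<open>k = 0\<close> the truncated \<open>k - 1\<close> is again 0, so
    \<open>c\<close> is set to 0 to suppress a spurious term with \<open>p 0\<close>.\<close>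
  define b c where "b = ip (potential (p k)) (p k) / ip (p k) (p k)"
    and "c = (if k = 0 then 0 else ip (p k) (p k) / ip (p (k - 1)) (p (k - 1)))"
  \<comment> \<open>The difference of the two sides, as coefficients in the \<open>P l\<close>;
    independence will make it vanish.\<close>
  define e where "e l = \<omega> (Suc k) l - (case l of 0 \<Rightarrow> zeta k | Suc i \<Rightarrow> \<omega> k i)
    + b * (if l \<le> k then \<omega> k l else 0) + c * (if l \<le> k - 1 then \<omega> (k - 1) l else 0)" for l
  have "(\<Sum>l\<le>Suc k. e l * P l x) = 0" if "x \<in> SG q" for x
  proof -
    have "(\<Sum>l\<le>Suc k. e l * P l x)
        = p (Suc k) x - potential (p k) x + b * p k x + c * p (k - 1) x"
      unfolding potential_p[OF that] zeta_sum gram_schmidt_expansion[OF that] e_def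
        sum_P_extend[of k "Suc k", OF le_SucI[OF order_refl]]
        sum_P_extend[of "k - 1" "Suc k", OF order_trans[OF diff_le_self le_SucI[OF order_refl]]]
      by (simp add: algebra_simps sum.distrib sum_subtractf sum_distrib_left del: sum.atMost_Suc)
    also have "\<dots> = 0"
      unfolding three_term_recurrence[OF that, of k] b_def c_def by simp
    finally show ?thesis .
  qed
  then have "e l = 0" using assms by (rule P_independent)
  then have "\<omega> (Suc k) l = (case l of 0 \<Rightarrow> zeta k | Suc i \<Rightarrow> \<omega> k i)
      - b * (if l \<le> k then \<omega> k l else 0) - c * (if l \<le> k - 1 then \<omega> (k - 1) l else 0)"
    unfolding e_def by argo
  then show ?thesis
    by (cases "k = 0") (simp_all add: b_def c_def split del: if_split)
qed

end

theorem theorem3p5: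
  fixes q :: "3 \<Rightarrow> real^2"
    and \<mu> :: "(real^2) measure"
    and G :: "real^2 \<Rightarrow> real^2 \<Rightarrow> real"
    and P p f :: "nat \<Rightarrow> real^2 \<Rightarrow> real"
    and \<omega> :: "nat \<Rightarrow> nat \<Rightarrow> real"
    and d b c \<gamma> \<zeta> :: "nat \<Rightarrow> real"
    and \<Omega> :: "nat \<Rightarrow> real Matrix.vec"
  assumes "equilateral q"
    and "gasket_measure q \<mu>"
    and "green_function q \<mu> G"
    and "\<And>j. antisymmetric_monomial q j (P j)"
    and "p = gram_schmidt \<mu> P"
    and "\<And>k x. x \<in> SG q \<Longrightarrow> p k x = (\<Sum>l\<le>k. \<omega> k l * P l x)"
    and "\<And>k. \<omega> k k = 1"
    and "\<And>k. \<Omega> k = Matrix.vec (k + 1) (\<lambda>l. \<omega> k l)"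
    and "\<And>k. d k = 1 / L2_norm \<mu> (p k)"
    and "\<And>k x. x \<in> SG q \<Longrightarrow> f (k + 1) x = - (LINT y|\<mu>. G x y * p k y)"
    and "\<And>k. b k = (d k)\<^sup>2 * L2_inner \<mu> (f (k + 1)) (p k)"
    and "\<And>k. k \<ge> 1 \<Longrightarrow> c k = (d (k - 1))\<^sup>2 / (d k)\<^sup>2"
    and "\<And>l. \<gamma> l = P l (q 1)"
    and "\<And>k. \<zeta> k = - (1 / \<gamma> 0) * (\<Sum>l\<le>k. \<omega> k l * \<gamma> (l + 1))"
  shows "\<Omega> (k + 1) =
           (vec_of_list [\<zeta> k] @\<^sub>v \<Omega> k)
           - b k \<cdot>\<^sub>v (\<Omega> k @\<^sub>v 0\<^sub>v 1)
           - (if k = 0 then 0\<^sub>v (k + 2) else c k \<cdot>\<^sub>v (\<Omega> (k - 1) @\<^sub>v 0\<^sub>v 2))"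
proof -
  interpret gasket_orthogonal q \<mu> G P \<omega>
    by unfold_locales (use assms(1-7) in auto)
  have "\<zeta> k = zeta k" unfolding zeta_def assms(13,14) ..
  have b: "b k = L2_inner \<mu> (potential (p k)) (p k) / L2_inner \<mu> (p k) (p k)"
  proof -
    \<comment> \<open>\<open>f (k + 1)\<close> is prescribed on the gasket only, which is all that
      the inner product sees.\<close>
    have "L2_inner \<mu> (f (k + 1)) (p k) = L2_inner \<mu> (potential (p k)) (p k)"
      using assms(10) by (intro ip_cong) (auto simp: potential_def)
    then show ?thesis by (simp add: assms(9,11) inverse_norm_square)
  qed
  have c: "c k = L2_inner \<mu> (p k) (p k) / L2_inner \<mu> (p (k - 1)) (p (k - 1))" if "k \<noteq> 0"
    using that by (simp add: assms(9,12) inverse_norm_square)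
  show ?thesis
  proof (rule eq_vecI)
    fix l
    assume "l < dim_vec ((vec_of_list [\<zeta> k] @\<^sub>v \<Omega> k)
           - b k \<cdot>\<^sub>v (\<Omega> k @\<^sub>v 0\<^sub>v 1)
           - (if k = 0 then 0\<^sub>v (k + 2) else c k \<cdot>\<^sub>v (\<Omega> (k - 1) @\<^sub>v 0\<^sub>v 2)))"
    then have l: "l \<le> Suc k" by (auto simp: assms(8) split: if_splits)
    have 1: "vec_index (vec_of_list [\<zeta> k] @\<^sub>v \<Omega> k) l
        = (case l of 0 \<Rightarrow> zeta k | Suc i \<Rightarrow> \<omega> k i)"
      using l \<open>\<zeta> k = zeta k\<close> by (cases l) (auto simp: assms(8))
    have 2: "vec_index (\<Omega> k @\<^sub>v 0\<^sub>v 1) l = (if l \<le> k then \<omega> k l else 0)"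
      using l by (auto simp: assms(8))
    \<comment> \<open>At \<open>k = 0\<close> the padded vector would be \<Omega>_0 extended to
      length 3, one more than \<open>k + 2\<close>; the zero vector stands there instead.\<close>
    have 3: "vec_index (\<Omega> (k - 1) @\<^sub>v 0\<^sub>v 2) l = (if l \<le> k - 1 then \<omega> (k - 1) l else 0)"
      if "k \<noteq> 0"
      using l that by (auto simp: assms(8))
    have dim: "dim_vec (\<Omega> j) = j + 1" for j by (simp add: assms(8))
    have "vec_index (\<Omega> (k + 1)) l = \<omega> (Suc k) l"
      using l by (simp add: assms(8))
    also have "\<dots> = (case l of 0 \<Rightarrow> zeta k | Suc i \<Rightarrow> \<omega> k i)
        - b k * (if l \<le> k then \<omega> k l else 0)
        - (if k = 0 then 0 else c k * (if l \<le> k - 1 then \<omega> (k - 1) l else 0))"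
      using coefficient_recurrence[OF l] b c assms(5) by simp
    also have "\<dots> = vec_index ((vec_of_list [\<zeta> k] @\<^sub>v \<Omega> k)
           - b k \<cdot>\<^sub>v (\<Omega> k @\<^sub>v 0\<^sub>v 1)
           - (if k = 0 then 0\<^sub>v (k + 2) else c k \<cdot>\<^sub>v (\<Omega> (k - 1) @\<^sub>v 0\<^sub>v 2))) l"
      using l 1 2 3 by (auto simp: dim simp del: index_append_vec(1))
    finally show "vec_index (\<Omega> (k + 1)) l = vec_index ((vec_of_list [\<zeta> k] @\<^sub>v \<Omega> k)
           - b k \<cdot>\<^sub>v (\<Omega> k @\<^sub>v 0\<^sub>v 1)
           - (if k = 0 then 0\<^sub>v (k + 2) else c k \<cdot>\<^sub>v (\<Omega> (k - 1) @\<^sub>v 0\<^sub>v 2))) l" .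
  qed (auto simp: assms(8))
qed

end
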